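(* For any integer $k$, the set of graphs $G$ with $\mu(I_G)\leq k$ is closed under taking combinatorial retracts; that is, if $\mu(I_G)\leq k$ and $G'$ is a combinatorial retract of $G$, then $\mu(I_{G'})\leq k$.
   Context: $\mathbb{K}$ is a field. All graphs are finite and simple with non-empty vertex set; all graphs whose cut ideals are considered here are assumed to have at least one edge. For a graph $G=(V,E)$ let $S_G=\mathbb{K}[q_{A|B}]$ be the polynomial ring with one variable for each unordered partition $A|B$ of $V$ (i.e. $A\cup B=V$, $A\cap B=\emptyset$, empty parts allowed), standard graded, and $R_G=\mathbb{K}[s_{ij},t_{ij}:\{i,j\}\in E]$. Let $\mathrm{Cut}(A|B)\subseteq E$ be the set of edges with one endpoint in $A$ and the other in $B$. Let $\phi_G\colon S_G\to R_G$ be the $\mathbb{K}$-algebra homomorphism $q_{A|B}\mapsto \prod_{\{i,j\}\in \mathrm{Cut}(A|B)}s_{ij}\prod_{\{i,j\}\in E\setminus \mathrm{Cut}(A|B)}t_{ij}$. The cut ideal is the graded ideal $I_G=\ker\phi_G$. $\mu(I_G)$ denotes the highest degree of an element in a minimal (homogeneous) generating system of $I_G$ (read as $-\infty$ if $I_G=0$). $N_G(v)$ is the set of neighbors of $v$, $N_G[v]=N_G(v)\cup\{v\}$, $N_G(T)=\bigcup_{v\in T}N_G(v)$, and $G_W$ is the induced subgraph on $W$. Edge contraction: for $e=\{u,v\}\in E$, the contracted graph has vertex set $V'=(V\setminus\{u,v\})\cup\{w\}$ with $w$ new and edge set $\{f\in E: f\cap\{u,v\}=\emptyset\}\cup\{\{w,z\}: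 z\in V\setminus\{u,v\},\ z \text{ adjacent to } u \text{ or } v\}$. Neighborhood-minor: if $V=W\cup W'$ with $W\cap W'=\emptyset$, $W,W'\neq\emptyset$, $H=G_W$, and there is a vertex $v\in W$ with $W\cap N_G(W')\subseteq N_H[v]$, then $H$ is a neighborhood-minor of $G$. Combinatorial retract: $G'$ is a combinatorial retract of $G$ if there is a sequence $G_0,\dots,G_r$ ($r\ge 0$) of graphs with $G_0=G$, $G_r=G'$ such that for each $i=1,\dots,r$, $G_i$ is either obtained by an edge contraction from $G_{i-1}$ or is a neighborhood-minor of $G_{i-1}$. *)

theory Defs
  imports Complex_Main "HOL-Library.Poly_Mapping" "HOL-Library.Extended_Real" "HOL-Algebra.RingHom"
begin

type_synonym 'a graph = "'a set \<times> 'a set set"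

abbreviation verts :: "'a graph \<Rightarrow> 'a set" where "verts \<equiv> fst"
abbreviation edges :: "'a graph \<Rightarrow> 'a set set" where "edges \<equiv> snd"

definition simple_graph :: "'a graph \<Rightarrow> bool" where
  "simple_graph G \<longleftrightarrow> finite (verts G) \<and> verts G \<noteq> {} \<and>
     (\<forall>e\<in>edges G. e \<subseteq> verts G \<and> card e = 2)"

definition nbrs :: "'a graph \<Rightarrow> 'a \<Rightarrow> 'a set" where
  "nbrs G v = {u. {u, v} \<in> edges G}"

definition closed_nbrs :: "'a graph \<Rightarrow> 'a \<Rightarrow> 'a set" where
  "closed_nbrs G v = nbrs G v \<union> {v}"

definition set_nbrs :: "'a graph \<Rightarrow> 'a set \<Rightarrow> 'a set" where
  "set_nbrs G T = (\<Union>v\<in>T. nbrs G v)"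

definition induced :: "'a graph \<Rightarrow> 'a set \<Rightarrow> 'a graph" where
  "induced G W = (W, {e \<in> edges G. e \<subseteq> W})"

definition contract :: "'a graph \<Rightarrow> 'a \<Rightarrow> 'a \<Rightarrow> 'a \<Rightarrow> 'a graph" where
  "contract G u v w =
     ((verts G - {u, v}) \<union> {w},
      {f \<in> edges G. f \<inter> {u, v} = {}} \<union>
      {{w, z} | z. z \<in> verts G - {u, v} \<and> ({z, u} \<in> edges G \<or> {z, v} \<in> edges G)})"

text \<open>The merged vertex \<open>w\<close> may be any element distinct from the remaining vertices. It may
  reuse the name \<open>u\<close> or \<open>v\<close>, so that contractions exist also when the vertices
  exhaust a finite type.\<close>

definition edge_contraction :: "'a graph \<Rightarrow> 'a graph \<Rightarrow> bool" where
  "edge_contraction G G' \<longleftrightarrow>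
     (\<exists>u v w. {u, v} \<in> edges G \<and> w \<notin> verts G - {u, v} \<and> G' = contract G u v w)"

definition neighborhood_minor :: "'a graph \<Rightarrow> 'a graph \<Rightarrow> bool" where
  "neighborhood_minor G H \<longleftrightarrow>
     (\<exists>W W'. verts G = W \<union> W' \<and> W \<inter> W' = {} \<and> W \<noteq> {} \<and> W' \<noteq> {} \<and>
        H = induced G W \<and> (\<exists>v\<in>W. W \<inter> set_nbrs G W' \<subseteq> closed_nbrs H v))"

definition combinatorial_retract :: "'a graph \<Rightarrow> 'a graph \<Rightarrow> bool" where
  "combinatorial_retract = (\<lambda>G G'. edge_contraction G G' \<or> neighborhood_minor G G')\<^sup>*\<^sup>*"

text \<open>A polynomial is a finitely supported map from monomials (finitely supported exponent
  vectors) to coefficients; the variables allowed in a given ring are singled out by the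
  carrier.\<close>

type_synonym ('x, 'k) mpoly = "('x \<Rightarrow>\<^sub>0 nat) \<Rightarrow>\<^sub>0 'k"

definition mvar :: "'x \<Rightarrow> ('x, 'k::field) mpoly" where
  "mvar x = Poly_Mapping.single (Poly_Mapping.single x 1) 1"

definition mpoly_ring :: "'x set \<Rightarrow> ('x, 'k::field) mpoly ring" where
  "mpoly_ring X =
     \<lparr>carrier = {p. \<forall>m\<in>Poly_Mapping.keys p. Poly_Mapping.keys m \<subseteq> X},
      monoid.mult = (*), one = 1, ring.zero = 0, add = (+)\<rparr>"

text \<open>The algebra homomorphism over the coefficient field determined by the images
  \<open>f x\<close> of the variables.\<close>

definition mpoly_hom :: "('x \<Rightarrow> ('y, 'k) mpoly) \<Rightarrow> ('x, 'k::field) mpoly \<Rightarrow> ('y, 'k) mpoly" where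
  "mpoly_hom f p =
     (\<Sum>m\<in>Poly_Mapping.keys p. Poly_Mapping.single 0 (Poly_Mapping.lookup p m) *
        (\<Prod>x\<in>Poly_Mapping.keys m. f x ^ Poly_Mapping.lookup m x))"

definition monom_degree :: "('x \<Rightarrow>\<^sub>0 nat) \<Rightarrow> nat" where
  "monom_degree m = (\<Sum>x\<in>Poly_Mapping.keys m. Poly_Mapping.lookup m x)"

definition homogeneous :: "('x, 'k::field) mpoly \<Rightarrow> bool" where
  "homogeneous p \<longleftrightarrow> (\<exists>d. \<forall>m\<in>Poly_Mapping.keys p. monom_degree m = d)"

definition total_degree :: "('x, 'k::field) mpoly \<Rightarrow> nat" where
  "total_degree p = Max (monom_degree ` Poly_Mapping.keys p)"

definition minimal_generating_system ::
  "('x, 'k::field) mpoly ring \<Rightarrow> ('x, 'k) mpoly set \<Rightarrow> ('x, 'k) mpoly set \<Rightarrow> bool" where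
  "minimal_generating_system S I F \<longleftrightarrow>
     F \<subseteq> carrier S \<and> (\<forall>f\<in>F. homogeneous f) \<and> Idl\<^bsub>S\<^esub> F = I \<and>
     (\<forall>F'. F' \<subset> F \<longrightarrow> Idl\<^bsub>S\<^esub> F' \<noteq> I)"

text \<open>All minimal homogeneous generating systems of a graded ideal have the same degrees, so
  the supremum over all of them is the maximal degree in any one of them. Zero is
  never a member of such a system, so \<open>total_degree\<close> is only applied to nonzero
  polynomials; for the zero ideal the system is empty and the supremum is
  \<open>-\<infinity>\<close>.\<close>

definition max_generator_degree ::
  "('x, 'k::field) mpoly ring \<Rightarrow> ('x, 'k) mpoly set \<Rightarrow> ereal" where
  "max_generator_degree S I =
     (SUP f \<in> \<Union>{F. minimal_generating_system S I F}. ereal (real (total_degree f)))"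

text \<open>The unordered partition \<open>A|B\<close> is encoded as the set \<open>{A, B}\<close>.\<close>

definition bipartitions :: "'a set \<Rightarrow> 'a set set set" where
  "bipartitions V = {{A, B} | A B. A \<union> B = V \<and> A \<inter> B = {}}"

definition cut :: "'a graph \<Rightarrow> 'a set set \<Rightarrow> 'a set set" where
  "cut G P = {e \<in> edges G. \<exists>A B i j. P = {A, B} \<and> i \<in> A \<and> j \<in> B \<and> e = {i, j}}"

datatype 'e edge_var = S_var 'e | T_var 'e

definition cut_source_ring :: "'a graph \<Rightarrow> ('a set set, 'k::field) mpoly ring" where
  "cut_source_ring G = mpoly_ring (bipartitions (verts G))"

definition cut_target_ring :: "'a graph \<Rightarrow> ('a set edge_var, 'k::field) mpoly ring" where
  "cut_target_ring G = mpoly_ring (S_var ` edges G \<union> T_var ` edges G)"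

definition cut_map ::
  "'a graph \<Rightarrow> ('a set set, 'k::field) mpoly \<Rightarrow> ('a set edge_var, 'k) mpoly" where
  "cut_map G = mpoly_hom (\<lambda>P. (\<Prod>e\<in>cut G P. mvar (S_var e)) *
                              (\<Prod>e\<in>edges G - cut G P. mvar (T_var e)))"

definition cut_ideal :: "'a graph \<Rightarrow> ('a set set, 'k::field) mpoly set" where
  "cut_ideal G = a_kernel (cut_source_ring G) (cut_target_ring G) (cut_map G)"

definition mu_cut_ideal :: "'k::field itself \<Rightarrow> 'a graph \<Rightarrow> ereal" where
  "mu_cut_ideal _ G =
     max_generator_degree (cut_source_ring G) (cut_ideal G :: ('a set set, 'k) mpoly set)"

end

theory Submission
  imports Defs
begin

text \<open>An edge contraction or neighborhood-minor \<open>G'\<close> of \<open>G\<close> comes with a map \<open>c\<close> of \<open>G\<close> onto \<open>G'\<close> that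
  sends edges to edges or points. Pulling bipartitions back along \<open>c\<close> gives a degree-preserving
  map \<open>\<iota>\<close> of the polynomial rings, and pulling back along a section of \<open>c\<close> (or sending to \<open>0\<close> the
  bipartitions that cut the contracted edge) gives a left inverse \<open>\<pi>\<close>. Both extend to the rings in
  the variables \<open>s, t\<close>, so they respect the cut ideals: \<open>K[G']\<close> is a graded algebra retract of
  \<open>K[G]\<close>, and \<open>\<pi>\<close> maps generators of \<open>I_G\<close> to generators of \<open>I_G'\<close>. It remains to see that
  \<open>\<mu>(I) \<le> k\<close> holds iff \<open>I\<close> is generated by homogeneous elements of degree at most \<open>k\<close>.\<close>

section \<open>Substitution homomorphisms between polynomial rings\<close>

abbreviation keys where "keys \<equiv> Poly_Mapping.keys"
abbreviation lookup where "lookup \<equiv> Poly_Mapping.lookup"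
abbreviation single where "single \<equiv> Poly_Mapping.single"

text \<open>The coefficient monoid is left general so that the same induction runs over the terms of
  a polynomial and over the variables of an exponent vector.\<close>

lemma mpoly_induct [case_names zero plus]:
  fixes p :: "'x \<Rightarrow>\<^sub>0 'b::comm_monoid_add"
  assumes "P 0" and "\<And>m c p. P p \<Longrightarrow> P (single m c + p)"
  shows "P p"
proof (induction p rule: Poly_Mapping.update_induct)
  case const
  show ?case by (fact assms(1))
next
  case (update f a b)
  have "Poly_Mapping.update a b f = single a b + f"
    using update(1)
    by (intro poly_mapping_eqI) (auto simp: lookup_update lookup_add lookup_single when_def in_keys_iff)
  then show ?case using assms(2) update(3) by simp
qed

definition monom_eval :: "('x \<Rightarrow> 'r) \<Rightarrow> ('x \<Rightarrow>\<^sub>0 nat) \<Rightarrow> 'r::comm_semiring_1" where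
  "monom_eval f m = (\<Prod>x\<in>keys m. f x ^ lookup m x)"

text \<open>Indices outside the support contribute zeroth powers. A common finite index set makes
  products for different monomials comparable factor by factor; \<open>mpoly_hom_superset\<close>
  does the same for sums.\<close>

lemma monom_eval_superset:
  assumes "finite A" "keys m \<subseteq> A"
  shows "monom_eval f m = (\<Prod>x\<in>A. f x ^ lookup m x)"
  unfolding monom_eval_def using assms
  by (intro prod.mono_neutral_left) (auto simp: in_keys_iff)

lemma monom_eval_zero [simp]: "monom_eval f 0 = 1"
  by (simp add: monom_eval_def)

lemma monom_eval_add: "monom_eval f (m + n) = monom_eval f m * monom_eval f n"
proof -
  let ?A = "keys m \<union> keys n"
  have "keys (m + n) \<subseteq> ?A" by (rule Poly_Mapping.keys_add)
  then show ?thesis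
    by (simp add: monom_eval_superset[where A = ?A] lookup_add power_add prod.distrib)
qed

lemma mpoly_hom_eq: "mpoly_hom f p = (\<Sum>m\<in>keys p. single 0 (lookup p m) * monom_eval f m)"
  by (simp add: mpoly_hom_def monom_eval_def)

lemma mpoly_hom_superset:
  assumes "finite A" "keys p \<subseteq> A"
  shows "mpoly_hom f p = (\<Sum>m\<in>A. single 0 (lookup p m) * monom_eval f m)"
  unfolding mpoly_hom_eq using assms
  by (intro sum.mono_neutral_left) (auto simp: in_keys_iff)

lemma mpoly_hom_zero [simp]: "mpoly_hom f 0 = 0"
  by (simp add: mpoly_hom_eq)

lemma mpoly_hom_single: "mpoly_hom f (single m c) = single 0 c * monom_eval f m"
  by (subst mpoly_hom_superset[where A = "{m}"]) auto

lemma mpoly_hom_const [simp]: "mpoly_hom f (single 0 c) = single 0 c"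
  by (simp add: mpoly_hom_single)

lemma mpoly_hom_one [simp]: "mpoly_hom f 1 = 1"
  using mpoly_hom_const[of f 1] by simp

lemma mpoly_hom_add: "mpoly_hom f (p + q) = mpoly_hom f p + mpoly_hom f q"
proof -
  let ?A = "keys p \<union> keys q"
  have "keys (p + q) \<subseteq> ?A" by (rule Poly_Mapping.keys_add)
  then show ?thesis
    by (simp add: mpoly_hom_superset[where A = ?A] lookup_add single_add distrib_right sum.distrib)
qed

lemma single_0_mult: "single 0 (c * d) = single 0 c * (single 0 d :: ('x, 'k::field) mpoly)"
  by (simp add: mult_single)

text \<open>Both sides are additive in \<open>p\<close> and in \<open>q\<close>, so two inductions
  reduce the claim to a product of two terms, where exponents add.\<close>

lemma mpoly_hom_mult: "mpoly_hom f (p * q) = mpoly_hom f p * mpoly_hom f q"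
proof (induction p rule: mpoly_induct)
  case (plus m c p)
  have "mpoly_hom f (single m c * q) = mpoly_hom f (single m c) * mpoly_hom f q"
  proof (induction q rule: mpoly_induct)
    case (plus n d q)
    have "mpoly_hom f (single m c * single n d) = mpoly_hom f (single m c) * mpoly_hom f (single n d)"
      unfolding mult_single mpoly_hom_single monom_eval_add
      by (simp only: single_0_mult mult_ac)
    with plus show ?case by (simp add: distrib_left mpoly_hom_add)
  qed simp
  with plus show ?case by (simp add: distrib_right mpoly_hom_add)
qed simp

lemma mpoly_hom_sum: "mpoly_hom f (sum g A) = (\<Sum>a\<in>A. mpoly_hom f (g a))"
  by (induction A rule: infinite_finite_induct) (auto simp: mpoly_hom_add)

lemma mpoly_hom_prod: "mpoly_hom f (prod g A) = (\<Prod>a\<in>A. mpoly_hom f (g a))"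
  by (induction A rule: infinite_finite_induct) (auto simp: mpoly_hom_mult)

lemma mpoly_hom_power: "mpoly_hom f (p ^ n) = mpoly_hom f p ^ n"
  by (induction n) (auto simp: mpoly_hom_mult)

lemma mpoly_hom_mvar [simp]: "mpoly_hom f (mvar x) = f x"
  by (simp add: mvar_def mpoly_hom_single monom_eval_def)

text \<open>This lets commuting squares of homomorphisms be checked on variables: both composites
  become single substitutions, which \<open>mpoly_hom_cong\<close> compares.\<close>

lemma mpoly_hom_comp: "mpoly_hom g (mpoly_hom f p) = mpoly_hom (\<lambda>x. mpoly_hom g (f x)) p"
  by (simp add: mpoly_hom_eq[of f] mpoly_hom_eq[of "\<lambda>x. mpoly_hom g (f x)"]
      mpoly_hom_sum mpoly_hom_mult monom_eval_def mpoly_hom_prod mpoly_hom_power)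

lemma mvar_power: "mvar x ^ n = single (single x n) 1"
proof (induction n)
  case (Suc n)
  have "single x 1 + single x n = single x (Suc n)"
    by (metis plus_1_eq_Suc single_add)
  then show ?case using Suc by (simp add: mvar_def mult_single)
qed simp

lemma monom_eval_mvar: "monom_eval mvar m = single m 1"
proof (induction m rule: mpoly_induct)
  case (plus x n m)
  have "monom_eval mvar (single x n) = (single (single x n) 1 :: ('a, 'b) mpoly)"
    by (cases "n = 0") (simp_all add: monom_eval_def mvar_power)
  with plus show ?case by (simp add: monom_eval_add mult_single)
qed simp

lemma mpoly_hom_id: "mpoly_hom mvar p = p"
  by (induction p rule: mpoly_induct)
    (simp_all add: mpoly_hom_add mpoly_hom_single monom_eval_mvar mult_single)

section \<open>Polynomials in a prescribed set of variables\<close>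

definition polys :: "'x set \<Rightarrow> ('x, 'k::field) mpoly set" where
  "polys X = {p. \<forall>m\<in>keys p. keys m \<subseteq> X}"

lemma carrier_mpoly_ring [simp]: "carrier (mpoly_ring X) = polys X"
  by (simp add: mpoly_ring_def polys_def)

lemma mpoly_ring_simps [simp]:
  "\<one>\<^bsub>mpoly_ring X\<^esub> = 1" "\<zero>\<^bsub>mpoly_ring X\<^esub> = 0"
  "p \<otimes>\<^bsub>mpoly_ring X\<^esub> q = p * q" "p \<oplus>\<^bsub>mpoly_ring X\<^esub> q = p + q"
  by (simp_all add: mpoly_ring_def)

lemma polys_const [simp]: "single 0 c \<in> polys X"
  by (auto simp: polys_def)

lemma polys_zero [simp]: "0 \<in> polys X"
  by (auto simp: polys_def)

lemma polys_one [simp]: "1 \<in> polys X"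
  by (auto simp: polys_def)

lemma polys_uminus: "p \<in> polys X \<Longrightarrow> - p \<in> polys X"
  by (auto simp: polys_def in_keys_iff)

lemma polys_add: "p \<in> polys X \<Longrightarrow> q \<in> polys X \<Longrightarrow> p + q \<in> polys X"
  using Poly_Mapping.keys_add[of p q] by (fastforce simp: polys_def)

lemma polys_mult:
  assumes "p \<in> polys X" "q \<in> polys X" shows "p * q \<in> polys X"
  unfolding polys_def
proof (intro CollectI ballI)
  fix m assume "m \<in> keys (p * q)"
  then obtain a b where "m = a + b" "a \<in> keys p" "b \<in> keys q"
    using keys_mult[of p q] by blast
  then show "keys m \<subseteq> X" using assms Poly_Mapping.keys_add[of a b] by (fastforce simp: polys_def)
qed

lemma polys_mvar: "x \<in> X \<Longrightarrow> mvar x \<in> polys X"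
  by (auto simp: polys_def mvar_def)

lemma polys_sum: "(\<And>a. a \<in> A \<Longrightarrow> g a \<in> polys X) \<Longrightarrow> sum g A \<in> polys X"
  by (induction A rule: infinite_finite_induct) (auto intro: polys_add)

lemma polys_prod: "(\<And>a. a \<in> A \<Longrightarrow> g a \<in> polys X) \<Longrightarrow> prod g A \<in> polys X"
  by (induction A rule: infinite_finite_induct) (auto intro: polys_mult)

lemma polys_power: "p \<in> polys X \<Longrightarrow> p ^ n \<in> polys X"
  by (induction n) (auto intro: polys_mult)

lemma mpoly_hom_polys:
  assumes "p \<in> polys X" "\<And>x. x \<in> X \<Longrightarrow> f x \<in> polys Y"
  shows "mpoly_hom f p \<in> polys Y"
  unfolding mpoly_hom_eq monom_eval_def
proof (intro polys_sum polys_mult polys_prod polys_power polys_const)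
  fix m x assume "m \<in> keys p" "x \<in> keys m"
  with assms(1) have "x \<in> X" by (auto simp: polys_def)
  then show "f x \<in> polys Y" by (rule assms(2))
qed

lemma mpoly_hom_cong:
  assumes "p \<in> polys X" "\<And>x. x \<in> X \<Longrightarrow> f x = g x"
  shows "mpoly_hom f p = mpoly_hom g p"
  unfolding mpoly_hom_eq monom_eval_def
proof (intro sum.cong arg_cong2[where f = "(*)"] prod.cong refl)
  fix m x assume "m \<in> keys p" "x \<in> keys m"
  with assms(1) have "x \<in> X" by (auto simp: polys_def)
  then show "f x ^ lookup m x = g x ^ lookup m x" by (simp add: assms(2))
qed

lemma cring_mpoly_ring: "cring (mpoly_ring X)"
proof (intro cringI abelian_groupI comm_monoidI)
  fix p :: "('a, 'b) mpoly" assume "p \<in> carrier (mpoly_ring X)"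
  then show "\<exists>q\<in>carrier (mpoly_ring X). q \<oplus>\<^bsub>mpoly_ring X\<^esub> p = \<zero>\<^bsub>mpoly_ring X\<^esub>"
    by (intro bexI[of _ "- p"]) (auto intro: polys_uminus)
qed (auto intro: polys_add polys_mult simp: algebra_simps)

section \<open>Ideals as sets of finite linear combinations\<close>

definition gen :: "'x set \<Rightarrow> ('x, 'k::field) mpoly set \<Rightarrow> ('x, 'k) mpoly set" where
  "gen X F = {\<Sum>f\<in>A. h f * f | A h. finite A \<and> A \<subseteq> F \<and> (\<forall>f\<in>A. h f \<in> polys X)}"

lemma genI: "finite A \<Longrightarrow> A \<subseteq> F \<Longrightarrow> (\<And>f. f \<in> A \<Longrightarrow> h f \<in> polys X) \<Longrightarrow> (\<Sum>f\<in>A. h f * f) \<in> gen X F"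
  unfolding gen_def by blast

lemma gen_zero [simp]: "0 \<in> gen X F"
  using genI[of "{}" F] by simp

lemma gen_mono: "F \<subseteq> F' \<Longrightarrow> gen X F \<subseteq> gen X F'"
  unfolding gen_def by blast

lemma gen_base: "f \<in> F \<Longrightarrow> f \<in> gen X F"
  using genI[of "{f}" F "\<lambda>_. 1"] by simp

lemma gen_add:
  assumes "p \<in> gen X F" "q \<in> gen X F" shows "p + q \<in> gen X F"
proof -
  obtain A h where p: "finite A" "A \<subseteq> F" "\<forall>f\<in>A. h f \<in> polys X" "p = (\<Sum>f\<in>A. h f * f)"
    using assms(1) unfolding gen_def by blast
  obtain B g where q: "finite B" "B \<subseteq> F" "\<forall>f\<in>B. g f \<in> polys X" "q = (\<Sum>f\<in>B. g f * f)"
    using assms(2) unfolding gen_def by blast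
  \<comment> \<open>Coefficients extended by zero turn both sums into sums over the union of
    \<open>A\<close> and \<open>B\<close>.\<close>
  let ?h = "\<lambda>f. (if f \<in> A then h f else 0)" and ?g = "\<lambda>f. (if f \<in> B then g f else 0)"
  have "p = (\<Sum>f\<in>A \<union> B. ?h f * f)"
    unfolding p(4) using p(1) q(1) by (intro sum.mono_neutral_cong_left) auto
  moreover have "q = (\<Sum>f\<in>A \<union> B. ?g f * f)"
    unfolding q(4) using p(1) q(1) by (intro sum.mono_neutral_cong_left) auto
  ultimately have "p + q = (\<Sum>f\<in>A \<union> B. (?h f + ?g f) * f)"
    by (simp only: distrib_right sum.distrib)
  also have "\<dots> \<in> gen X F"
    using p q by (intro genI) (auto intro: polys_add)
  finally show ?thesis .
qed

lemma gen_mult: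
  assumes "p \<in> gen X F" "r \<in> polys X" shows "r * p \<in> gen X F"
proof -
  obtain A h where p: "finite A" "A \<subseteq> F" "\<forall>f\<in>A. h f \<in> polys X" "p = (\<Sum>f\<in>A. h f * f)"
    using assms(1) unfolding gen_def by blast
  have "r * p = (\<Sum>f\<in>A. (r * h f) * f)"
    unfolding p(4) by (simp add: sum_distrib_left mult.assoc)
  also have "\<dots> \<in> gen X F"
    using p assms(2) by (intro genI) (auto intro: polys_mult)
  finally show ?thesis .
qed

text \<open>Closure is demanded only for sums and for multiples of generators, so \<open>J\<close>
  need not be known to be an ideal; it may be another span or a preimage of one.\<close>

lemma gen_least:
  assumes "0 \<in> J" "\<And>p q. p \<in> J \<Longrightarrow> q \<in> J \<Longrightarrow> p + q \<in> J"
    and "\<And>h f. f \<in> F \<Longrightarrow> h \<in> polys X \<Longrightarrow> h * f \<in> J"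
  shows "gen X F \<subseteq> J"
proof
  fix p assume "p \<in> gen X F"
  then obtain A h where p: "finite A" "A \<subseteq> F" "\<forall>f\<in>A. h f \<in> polys X" "p = (\<Sum>f\<in>A. h f * f)"
    unfolding gen_def by blast
  from p(1-3) have "(\<Sum>f\<in>A. h f * f) \<in> J"
    by (induction A rule: finite_induct) (auto intro: assms)
  then show "p \<in> J" using p(4) by simp
qed

lemma gen_subset_gen: "F \<subseteq> gen X F' \<Longrightarrow> gen X F \<subseteq> gen X F'"
  by (rule gen_least) (auto intro: gen_add gen_mult)

lemma gen_remove_zero: "gen X (F - {0}) = gen X F"
proof
  have "f \<in> gen X (F - {0})" if "f \<in> F" for f
    using that by (cases "f = 0") (auto intro: gen_base)
  then have "F \<subseteq> gen X (F - {0})" by blast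
  then show "gen X F \<subseteq> gen X (F - {0})" by (rule gen_subset_gen)
qed (simp add: gen_mono)

lemma gen_polys: "F \<subseteq> polys X \<Longrightarrow> gen X F \<subseteq> polys X"
  by (rule gen_least) (auto intro: polys_add polys_mult)

text \<open>The combinations form an ideal containing \<open>F\<close>, and every ideal containing
  \<open>F\<close> contains them. From here on ideals are handled through explicit coefficients, as
  comparisons of degrees require.\<close>

lemma genideal_mpoly_ring:
  fixes F :: "('x, 'k::field) mpoly set"
  assumes F: "F \<subseteq> polys X"
  shows "Idl\<^bsub>mpoly_ring X\<^esub> F = gen X F"
proof
  interpret R: cring "mpoly_ring X :: ('x, 'k) mpoly ring" by (rule cring_mpoly_ring)
  have minus: "\<ominus>\<^bsub>mpoly_ring X\<^esub> p = - p" if "p \<in> polys X" for p :: "('x, 'k) mpoly"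
    using that by (intro R.minus_equality) (auto intro: polys_uminus)
  have sub: "subgroup (gen X F) (add_monoid (mpoly_ring X))"
  proof (rule R.add.subgroupI)
    fix p assume p: "p \<in> gen X F"
    then have "- p = (- 1) * p" by simp
    also have "\<dots> \<in> gen X F" using p by (intro gen_mult polys_uminus) auto
    finally show "\<ominus>\<^bsub>mpoly_ring X\<^esub> p \<in> gen X F"
      using minus p gen_polys[OF F] by auto
  next
    show "gen X F \<noteq> {}" using gen_zero by blast
  qed (use gen_polys[OF F] in \<open>auto intro: gen_add\<close>)
  have "ideal (gen X F) (mpoly_ring X)"
  proof (rule idealI[OF R.ring_axioms sub])
    fix a x :: "('x, 'k) mpoly" assume "a \<in> gen X F" "x \<in> carrier (mpoly_ring X)"
    then show "x \<otimes>\<^bsub>mpoly_ring X\<^esub> a \<in> gen X F" "a \<otimes>\<^bsub>mpoly_ring X\<^esub> x \<in> gen X F"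
      using gen_mult[of a X F x] by (auto simp: mult.commute)
  qed
  then show "Idl\<^bsub>mpoly_ring X\<^esub> F \<subseteq> gen X F"
    by (rule R.genideal_minimal) (auto intro: gen_base)
  interpret I: ideal "Idl\<^bsub>mpoly_ring X\<^esub> F" "mpoly_ring X"
    using F by (intro R.genideal_ideal) simp
  show "gen X F \<subseteq> Idl\<^bsub>mpoly_ring X\<^esub> F"
  proof (rule gen_least)
    show "0 \<in> Idl\<^bsub>mpoly_ring X\<^esub> F" using I.zero_closed by simp
    show "p + q \<in> Idl\<^bsub>mpoly_ring X\<^esub> F" if "p \<in> Idl\<^bsub>mpoly_ring X\<^esub> F" "q \<in> Idl\<^bsub>mpoly_ring X\<^esub> F" for p q
      using I.a_closed[OF that] by simp
    show "h * f \<in> Idl\<^bsub>mpoly_ring X\<^esub> F" if "f \<in> F" "h \<in> polys X" for h f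
      using I.I_l_closed[of f h] that R.genideal_self[of F] F by auto
  qed
qed

section \<open>Homogeneous polynomials and homogeneous components\<close>

definition homog :: "nat \<Rightarrow> ('x, 'k::field) mpoly \<Rightarrow> bool" where
  "homog d p \<longleftrightarrow> (\<forall>m\<in>keys p. monom_degree m = d)"

lemma homogeneous_iff_homog: "homogeneous p \<longleftrightarrow> (\<exists>d. homog d p)"
  by (simp add: homogeneous_def homog_def)

lemma homog_total_degree:
  assumes "homog d p" "p \<noteq> 0" shows "total_degree p = d"
proof -
  obtain m where "m \<in> keys p" using assms(2) by (metis keys_eq_empty ex_in_conv)
  then have "monom_degree ` keys p = {d}" using assms(1) by (force simp: homog_def)
  then show ?thesis by (simp add: total_degree_def)
qed

lemma monom_degree_superset:
  "finite A \<Longrightarrow> keys m \<subseteq> A \<Longrightarrow> monom_degree m = (\<Sum>x\<in>A. lookup m x)"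
  unfolding monom_degree_def by (intro sum.mono_neutral_left) (auto simp: in_keys_iff)

lemma monom_degree_add: "monom_degree (m + n) = monom_degree m + monom_degree n"
proof -
  let ?A = "keys m \<union> keys n"
  have "keys (m + n) \<subseteq> ?A" by (rule Poly_Mapping.keys_add)
  then show ?thesis
    by (simp add: monom_degree_superset[where A = ?A] lookup_add sum.distrib)
qed

lemma monom_degree_zero [simp]: "monom_degree 0 = 0"
  by (simp add: monom_degree_def)

lemma monom_degree_eq_0: "monom_degree m = 0 \<longleftrightarrow> m = 0"
  by (auto simp: monom_degree_def in_keys_iff intro: poly_mapping_eqI)

lemma homog_zero [simp]: "homog d 0"
  by (simp add: homog_def)

lemma homog_const [simp]: "homog 0 (single 0 c)"
  by (simp add: homog_def)

lemma homog_one [simp]: "homog 0 1"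
  by (simp add: homog_def)

lemma homog_mvar: "homog (Suc 0) (mvar x)"
  by (simp add: homog_def mvar_def monom_degree_def)

lemma homog_add: "homog d p \<Longrightarrow> homog d q \<Longrightarrow> homog d (p + q)"
  using Poly_Mapping.keys_add[of p q] by (fastforce simp: homog_def)

lemma homog_mult:
  assumes "homog a p" "homog b q" shows "homog (a + b) (p * q)"
  unfolding homog_def
proof
  fix m assume "m \<in> keys (p * q)"
  then obtain s t where "m = s + t" "s \<in> keys p" "t \<in> keys q"
    using keys_mult[of p q] by blast
  then show "monom_degree m = a + b" using assms by (simp add: homog_def monom_degree_add)
qed

lemma homog_sum: "(\<And>a. a \<in> A \<Longrightarrow> homog d (g a)) \<Longrightarrow> homog d (sum g A)"
  by (induction A rule: infinite_finite_induct) (auto intro: homog_add)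

lemma homog_prod: "(\<And>a. a \<in> A \<Longrightarrow> homog (d a) (g a)) \<Longrightarrow> homog (sum d A) (prod g A)"
  by (induction A rule: infinite_finite_induct) (auto intro: homog_mult)

lemma homog_power: "homog d p \<Longrightarrow> homog (n * d) (p ^ n)"
  by (induction n) (auto intro: homog_mult)

text \<open>Only the zero monomial has degree 0. In a homogeneous relation this makes a coefficient
  of degree 0 a scalar, which can be inverted unless it vanishes.\<close>

lemma homog_0_imp_const:
  assumes "homog 0 p" shows "\<exists>c. p = single 0 c"
proof
  show "p = single 0 (lookup p 0)"
    using assms
    by (intro poly_mapping_eqI)
      (auto simp: homog_def monom_degree_eq_0 lookup_single when_def in_keys_iff)
qed

lemma homog_mpoly_hom:
  assumes "p \<in> polys X" "homog d p" "\<And>x. x \<in> X \<Longrightarrow> homog n (f x)"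
  shows "homog (d * n) (mpoly_hom f p)"
  unfolding mpoly_hom_eq monom_eval_def
proof (rule homog_sum)
  fix m assume m: "m \<in> keys p"
  have "homog (\<Sum>x\<in>keys m. lookup m x * n) (\<Prod>x\<in>keys m. f x ^ lookup m x)"
    using m assms(1,3) by (intro homog_prod homog_power) (auto simp: polys_def)
  moreover have "(\<Sum>x\<in>keys m. lookup m x * n) = d * n"
    using m assms(2) by (simp add: homog_def monom_degree_def flip: sum_distrib_right)
  ultimately show "homog (d * n) (single 0 (lookup p m) * (\<Prod>x\<in>keys m. f x ^ lookup m x))"
    using homog_mult[OF homog_const] by fastforce
qed

definition hcomp :: "nat \<Rightarrow> ('x, 'k::field) mpoly \<Rightarrow> ('x, 'k) mpoly" where
  "hcomp d p = Poly_Mapping.mapp (\<lambda>m c. c when monom_degree m = d) p"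

lemma lookup_hcomp: "lookup (hcomp d p) m = (lookup p m when monom_degree m = d)"
  by (auto simp: hcomp_def lookup_mapp when_def in_keys_iff)

lemma hcomp_add: "hcomp d (p + q) = hcomp d p + hcomp d q"
  by (intro poly_mapping_eqI) (simp add: lookup_hcomp lookup_add when_def)

lemma hcomp_sum: "hcomp d (sum g A) = (\<Sum>a\<in>A. hcomp d (g a))"
  by (intro poly_mapping_eqI) (simp add: lookup_hcomp lookup_sum when_def)

lemma homog_hcomp: "homog d (hcomp d p)"
  by (simp add: homog_def in_keys_iff lookup_hcomp)

lemma hcomp_polys: "p \<in> polys X \<Longrightarrow> hcomp d p \<in> polys X"
  by (simp add: polys_def in_keys_iff lookup_hcomp)

lemma hcomp_homog: "homog e p \<Longrightarrow> hcomp d p = (if d = e then p else 0)"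
  by (intro poly_mapping_eqI) (auto simp: lookup_hcomp when_def homog_def in_keys_iff)

lemma sum_hcomp: "p = (\<Sum>d\<in>monom_degree ` keys p. hcomp d p)"
  by (intro poly_mapping_eqI) (auto simp: lookup_sum lookup_hcomp when_def in_keys_iff)

text \<open>Multiplication by \<open>f\<close> shifts every component up by \<open>e\<close>. The
  case \<open>e > d\<close> is separate because \<open>d - e\<close> is truncated
  subtraction.\<close>

lemma hcomp_mult_homog:
  assumes "homog e f"
  shows "hcomp d (h * f) = (if e \<le> d then hcomp (d - e) h * f else 0)"
proof (induction h rule: mpoly_induct)
  case zero
  show ?case by (simp add: hcomp_homog[of 0 0])
next
  case (plus m c h)
  let ?n = "monom_degree m"
  have m: "homog ?n (single m c)" by (simp add: homog_def)
  have "hcomp d (single m c * f) = (if e \<le> d then hcomp (d - e) (single m c) * f else 0)"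
    using hcomp_homog[OF homog_mult[OF m assms], of d] hcomp_homog[OF m, of "d - e"] by auto
  with plus show ?case by (simp add: hcomp_add distrib_right)
qed

text \<open>Taking components of degree \<open>d\<close> in a relation leaves \<open>p\<close>
  unchanged and makes the coefficients homogeneous of complementary degree. Discarding zero
  generators and zero coefficients keeps \<open>total_degree\<close> meaningful and makes
  coefficients of degree 0 invertible.\<close>

lemma homog_in_gen:
  assumes p: "p \<in> gen X F" "homog d p" and F: "\<And>f. f \<in> F \<Longrightarrow> homogeneous f"
  shows "\<exists>A h. finite A \<and> A \<subseteq> F \<and> p = (\<Sum>f\<in>A. h f * f) \<and>
    (\<forall>f\<in>A. f \<noteq> 0 \<and> total_degree f \<le> d \<and> h f \<in> polys X \<and>
      homog (d - total_degree f) (h f) \<and> h f \<noteq> 0)"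
proof -
  obtain B g where B: "finite B" "B \<subseteq> F" "\<forall>f\<in>B. g f \<in> polys X" "p = (\<Sum>f\<in>B. g f * f)"
    using p(1) unfolding gen_def by blast
  define h where "h f = hcomp (d - total_degree f) (g f)" for f
  define A where "A = {f\<in>B. f \<noteq> 0 \<and> total_degree f \<le> d \<and> h f \<noteq> 0}"
  have "p = hcomp d p" using hcomp_homog[OF p(2)] by simp
  also have "\<dots> = (\<Sum>f\<in>B. hcomp d (g f * f))" by (simp add: B(4) hcomp_sum)
  also have "\<dots> = (\<Sum>f\<in>A. h f * f)"
  proof (rule sum.mono_neutral_cong_right)
    have *: "hcomp d (g f * f) = (if total_degree f \<le> d then h f * f else 0)" if f: "f \<in> B" "f \<noteq> 0" for f
    proof -
      obtain e where e: "homog e f" using F f(1) B(2) homogeneous_iff_homog by blast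
      then show ?thesis using hcomp_mult_homog[OF e] homog_total_degree[OF e f(2)] by (simp add: h_def)
    qed
    show "\<forall>f\<in>B - A. hcomp d (g f * f) = 0"
    proof
      fix f assume f: "f \<in> B - A"
      show "hcomp d (g f * f) = 0"
      \<comment> \<open>\<open>total_degree 0\<close> is the maximum of an empty set, so zero is
        treated apart.\<close>
      proof (cases "f = 0")
        case True then show ?thesis by (simp add: hcomp_homog[of 0 0])
      next
        case False then show ?thesis using f *[of f] by (auto simp: A_def)
      qed
    qed
    show "hcomp d (g f * f) = h f * f" if "f \<in> A" for f using that *[of f] by (auto simp: A_def)
  qed (auto simp: A_def B(1))
  finally have "p = (\<Sum>f\<in>A. h f * f)" .
  moreover have "finite A" "A \<subseteq> F" using B by (auto simp: A_def)
  moreover have "f \<noteq> 0 \<and> total_degree f \<le> d \<and> h f \<in> polys X \<and> homog (d - total_degree f) (h f) \<and> h f \<noteq> 0"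
    if "f \<in> A" for f using that B(3) by (auto simp: A_def h_def homog_hcomp hcomp_polys)
  ultimately show ?thesis by blast
qed

section \<open>Minimal homogeneous generating systems\<close>

lemma minimal_generating_system_gen:
  assumes "minimal_generating_system (mpoly_ring X) I F"
  shows "F \<subseteq> polys X" "\<And>f. f \<in> F \<Longrightarrow> homogeneous f" "gen X F = I"
    "\<And>F'. F' \<subset> F \<Longrightarrow> gen X F' \<noteq> I"
proof -
  show F: "F \<subseteq> polys X" and "\<And>f. f \<in> F \<Longrightarrow> homogeneous f"
    using assms unfolding minimal_generating_system_def by auto
  show "gen X F = I"
    using assms genideal_mpoly_ring[OF F] unfolding minimal_generating_system_def by simp
  fix F' assume F': "F' \<subset> F"
  then have "F' \<subseteq> polys X" using F by blast
  moreover have "Idl\<^bsub>mpoly_ring X\<^esub> F' \<noteq> I"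
    using assms F' unfolding minimal_generating_system_def by blast
  ultimately show "gen X F' \<noteq> I" using genideal_mpoly_ring[of F' X] by simp
qed

text \<open>Well-order the homogeneous elements of the ideal, first by degree and then arbitrarily, and
  keep those that are not generated by their predecessors. Comparing the largest elements in a
  homogeneous relation shows that this system is irredundant; no Noetherian argument is needed.\<close>

lemma minimal_generating_system_exists:
  fixes I :: "('x, 'k::field) mpoly set"
  assumes IX: "I \<subseteq> polys X" and I: "gen X I = I"
    and graded: "\<And>p d. p \<in> I \<Longrightarrow> hcomp d p \<in> I"
  obtains F where "minimal_generating_system (mpoly_ring X) I F"
proof -
  obtain r :: "('x, 'k) mpoly rel" where r: "Well_order r" "Field r = UNIV"
    using well_ordering[where 'a = "('x, 'k) mpoly"] by (elim exE conjE)
  \<comment> \<open>Degrees are compared first; ties are broken by an arbitrary well-order of all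
    polynomials, made strict by removing \<open>Id\<close>.\<close>
  define lt where "lt = inv_image (less_than <*lex*> (r - Id)) (\<lambda>f. (total_degree f, f))"
  have wf: "wf lt"
    unfolding lt_def using r(1) by (intro wf_inv_image wf_lex_prod wf_less_than) (simp add: well_order_on_def)
  have "trans (r - Id)"
    using r(1) by (simp add: order_on_defs trans_diff_Id)
  then have trans: "trans lt"
    unfolding lt_def by (intro trans_inv_image trans_lex_prod) auto
  have total: "(f, g) \<in> lt \<or> (g, f) \<in> lt" if "f \<noteq> g" for f g
    using r that by (auto simp: lt_def order_on_defs total_on_def)
  have degree: "total_degree f \<le> total_degree g" if "(f, g) \<in> lt" for f g
    using that by (auto simp: lt_def)
  have asym: "(g, f) \<notin> lt" if "(f, g) \<in> lt" for f g
    using wf that by (meson wf_not_sym)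
  define H where "H = {f \<in> I. homogeneous f}"
  define F where "F = {f \<in> H. f \<notin> gen X {g \<in> H. (g, f) \<in> lt}}"
  have FH: "F \<subseteq> H" by (auto simp: F_def)
  have HI: "H \<subseteq> I" by (auto simp: H_def)
  have FX: "F \<subseteq> polys X" using FH HI IX by blast
  have H_gen: "f \<in> H \<longrightarrow> f \<in> gen X F" for f
    using wf
  proof (induction f rule: wf_induct_rule)
    case (less f)
    show ?case
    proof
      assume "f \<in> H"
      show "f \<in> gen X F"
      proof (cases "f \<in> F")
        case False
        then have "f \<in> gen X {g \<in> H. (g, f) \<in> lt}" using \<open>f \<in> H\<close> by (simp add: F_def)
        also have "\<dots> \<subseteq> gen X F" using less by (intro gen_subset_gen) auto
        finally show ?thesis .
      qed (rule gen_base)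
    qed
  qed
  \<comment> \<open>A general element is the sum of its homogeneous components, which lie in
    \<open>I\<close> by gradedness and are thus covered by \<open>H_gen\<close>.\<close>
  have "p \<in> gen X F" if "p \<in> I" for p
  proof -
    have "hcomp d p \<in> gen X F" for d
      using H_gen graded[OF that] homog_hcomp[of d p] by (auto simp: H_def homogeneous_iff_homog)
    then have "(\<Sum>d\<in>D. hcomp d p) \<in> gen X F" for D :: "nat set"
      by (induction D rule: infinite_finite_induct) (auto intro: gen_add)
    then show ?thesis by (subst sum_hcomp)
  qed
  then have FI: "gen X F = I"
    using gen_mono[of F I X] FH HI I by auto
  have irredundant: False if f: "f \<in> F" "f \<in> gen X (F - {f})" for f
  proof -
    have "f \<noteq> 0" using f(1) by (auto simp: F_def)
    have hom: "homogeneous g" if "g \<in> F" for g using that FH by (auto simp: H_def)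
    then obtain d where d: "homog d f" using f(1) homogeneous_iff_homog by blast
    have df: "total_degree f = d" using homog_total_degree[OF d \<open>f \<noteq> 0\<close>] .
    have homF: "homogeneous g" if "g \<in> F - {f}" for g using that hom by blast
    obtain A h where A: "finite A" "A \<subseteq> F - {f}" "f = (\<Sum>g\<in>A. h g * g)"
      and h: "\<forall>g\<in>A. g \<noteq> 0 \<and> total_degree g \<le> d \<and> h g \<in> polys X \<and>
        homog (d - total_degree g) (h g) \<and> h g \<noteq> 0"
      using homog_in_gen[OF f(2) d homF] by blast
    have "asymp_on (insert f A) (\<lambda>x y. (x, y) \<in> lt)"
      using asym by (simp add: asymp_on_def)
    moreover have "transp_on (insert f A) (\<lambda>x y. (x, y) \<in> lt)"
      using trans unfolding transp_on_def trans_def by blast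
    ultimately have "\<exists>M\<in>insert f A. \<forall>g\<in>insert f A. g \<noteq> M \<longrightarrow> \<not> (M, g) \<in> lt"
      using A(1) by (intro Finite_Set.bex_max_element) simp_all
    \<comment> \<open>In the relation among \<open>f\<close> and the members of \<open>A\<close>,
      the largest element \<open>M\<close> turns out to be a combination of the others. They all
      precede it, which contradicts \<open>M\<close> being in \<open>F\<close>.\<close>
    then obtain M where M: "M \<in> insert f A" "\<forall>g\<in>insert f A. g \<noteq> M \<longrightarrow> (M, g) \<notin> lt" by blast
    have below: "g \<in> {g \<in> H. (g, M) \<in> lt}" if "g \<in> insert f A" "g \<noteq> M" for g
      using that M(2) total[of g M] A(2) FH f(1) by auto
    have "M \<in> gen X {g \<in> H. (g, M) \<in> lt}"
    proof (cases "M = f")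
      case True
      then show ?thesis
        using A h below by (subst True, subst A(3), intro genI) auto
    next
      case False
      then have MA: "M \<in> A" using M(1) by simp
      have "(f, M) \<in> lt" using below[of f] False by auto
      \<comment> \<open>As \<open>f\<close> precedes \<open>M\<close>, the degree of
        \<open>M\<close> is at least \<open>d\<close>, and in the relation it is at most
        \<open>d\<close>. So the coefficient of \<open>M\<close> is a nonzero scalar, and the
        relation can be solved for \<open>M\<close>.\<close>
      then have "total_degree M = d" using degree[of f M] df bspec[OF h MA] by simp
      then have "homog 0 (h M)" using bspec[OF h MA] by simp
      then obtain c where c: "h M = single 0 c" using homog_0_imp_const by blast
      then have "c \<noteq> 0" using bspec[OF h MA] by auto
      define i :: "('x, 'k) mpoly" where "i = single 0 (inverse c)"
      have i: "i * h M = 1" using \<open>c \<noteq> 0\<close> by (simp add: i_def c mult_single)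
      have "f = h M * M + (\<Sum>g\<in>A - {M}. h g * g)"
        unfolding A(3) by (rule sum.remove[OF A(1) MA])
      then have "i * f = i * (h M * M + (\<Sum>g\<in>A - {M}. h g * g))"
        by (rule arg_cong)
      also have "\<dots> = M + i * (\<Sum>g\<in>A - {M}. h g * g)"
        by (simp add: distrib_left i flip: mult.assoc)
      moreover have "(\<Sum>g\<in>A - {M}. (- i * h g) * g) = - (i * (\<Sum>g\<in>A - {M}. h g * g))"
        by (simp add: sum_distrib_left sum_negf mult.assoc)
      ultimately have "M = i * f + (\<Sum>g\<in>A - {M}. (- i * h g) * g)"
        by simp
      also have "\<dots> \<in> gen X {g \<in> H. (g, M) \<in> lt}"
      proof (rule gen_add)
        have "f \<in> {g \<in> H. (g, M) \<in> lt}" using below[of f] False by blast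
        then show "i * f \<in> gen X {g \<in> H. (g, M) \<in> lt}"
          by (intro gen_mult gen_base) (simp_all add: i_def)
        show "(\<Sum>g\<in>A - {M}. (- i * h g) * g) \<in> gen X {g \<in> H. (g, M) \<in> lt}"
        proof (rule genI)
          show "- i * h g \<in> polys X" if "g \<in> A - {M}" for g
            using that h by (intro polys_mult polys_uminus) (auto simp: i_def)
        qed (use A(1) below in auto)
      qed
      finally show ?thesis .
    qed
    moreover have "M \<in> F" using M(1) A(2) f(1) by blast
    ultimately show False by (simp add: F_def)
  qed
  have "gen X F' \<noteq> I" if F': "F' \<subset> F" for F'
  proof
    assume "gen X F' = I"
    obtain f where f: "f \<in> F" "f \<notin> F'" using F' by blast
    then have "f \<in> gen X F'" using \<open>gen X F' = I\<close> FH HI by blast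
    also have "\<dots> \<subseteq> gen X (F - {f})" using F' f by (intro gen_mono) auto
    finally show False using irredundant f(1) by blast
  qed
  then have "Idl\<^bsub>mpoly_ring X\<^esub> F' \<noteq> I" if "F' \<subset> F" for F'
    using genideal_mpoly_ring[of F' X] that FX by (metis order_trans psubset_imp_subset)
  then have "minimal_generating_system (mpoly_ring X) I F"
    unfolding minimal_generating_system_def
    using FX FH FI genideal_mpoly_ring[OF FX] by (auto simp: H_def)
  then show ?thesis by (rule that)
qed

section \<open>Generation in bounded degree and its passage to retracts\<close>

definition generated_upto :: "'x set \<Rightarrow> int \<Rightarrow> ('x, 'k::field) mpoly set \<Rightarrow> bool" where
  "generated_upto X k I \<longleftrightarrow>
     (\<exists>F\<subseteq>polys X. (\<forall>f\<in>F. \<exists>d. int d \<le> k \<and> homog d f) \<and> gen X F = I)"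

text \<open>The bound on the supremum applies to the system supplied by
  \<open>minimal_generating_system_exists\<close>. Its members are nonzero by minimality, so
  \<open>total_degree\<close> is their true degree. For negative \<open>k\<close> the system is
  empty.\<close>

lemma generated_upto_if_max_generator_degree_le:
  assumes "I \<subseteq> polys X" "gen X I = I" "\<And>p d. p \<in> I \<Longrightarrow> hcomp d p \<in> I"
    and le: "max_generator_degree (mpoly_ring X) I \<le> ereal (real_of_int k)"
  shows "generated_upto X k I"
proof -
  obtain F where F: "minimal_generating_system (mpoly_ring X) I F"
    using minimal_generating_system_exists[OF assms(1-3)] by blast
  note gen = minimal_generating_system_gen[OF F]
  have "\<exists>d. int d \<le> k \<and> homog d f" if f: "f \<in> F" for f
  proof -
    have "f \<noteq> 0"
    proof
      assume "f = 0"
      then have "F - {0} \<subset> F" using f by blast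
      then show False using gen(3,4) gen_remove_zero by blast
    qed
    obtain d where d: "homog d f" using gen(2)[OF f] homogeneous_iff_homog by blast
    have "ereal (real (total_degree f)) \<le> max_generator_degree (mpoly_ring X) I"
      unfolding max_generator_degree_def using F f by (intro SUP_upper) auto
    then have "ereal (real (total_degree f)) \<le> ereal (real_of_int k)"
      using le by (rule order_trans)
    then have "int (total_degree f) \<le> k" by simp
    then show ?thesis using d homog_total_degree[OF d \<open>f \<noteq> 0\<close>] by auto
  qed
  then show ?thesis unfolding generated_upto_def using gen(1,3) by blast
qed

text \<open>Suppose a minimal system had a member \<open>f\<close> of degree above \<open>k\<close>.
  Generators of degree at most \<open>k\<close> are combinations of members of no larger degree,
  hence without \<open>f\<close>, so \<open>f\<close> would be redundant.\<close>

lemma max_generator_degree_le_if_generated_upto: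
  assumes "generated_upto X k I"
  shows "max_generator_degree (mpoly_ring X) I \<le> ereal (real_of_int k)"
  unfolding max_generator_degree_def
proof (rule SUP_least, clarify)
  fix F f assume F: "minimal_generating_system (mpoly_ring X) I F" and f: "f \<in> F"
  note gen = minimal_generating_system_gen[OF F]
  obtain J where J: "\<forall>g\<in>J. \<exists>d. int d \<le> k \<and> homog d g" "gen X J = I"
    using assms unfolding generated_upto_def by blast
  show "ereal (real (total_degree f)) \<le> ereal (real_of_int k)"
  proof (rule ccontr)
    assume "\<not> ?thesis"
    then have fk: "k < int (total_degree f)" by simp
    have "g \<in> gen X (F - {f})" if g: "g \<in> J" for g
    proof -
      obtain d where d: "int d \<le> k" "homog d g" using J(1) g by blast
      have gF: "g \<in> gen X F" using gen_base[OF g, of X] J(2) gen(3) by simp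
      then obtain A h where A: "finite A" "A \<subseteq> F" "g = (\<Sum>a\<in>A. h a * a)"
        and h: "\<forall>a\<in>A. a \<noteq> 0 \<and> total_degree a \<le> d \<and> h a \<in> polys X \<and>
          homog (d - total_degree a) (h a) \<and> h a \<noteq> 0"
        using homog_in_gen[OF gF d(2) gen(2)] by blast
      have "f \<notin> A" using h fk d(1) by fastforce
      then show ?thesis unfolding A(3) using A(1,2) h by (intro genI) auto
    qed
    then have "I \<subseteq> gen X (F - {f})" using J(2) gen_subset_gen by blast
    then have "gen X (F - {f}) = I" using gen(3) gen_mono[of "F - {f}" F X] by blast
    moreover have "F - {f} \<subset> F" using f by blast
    ultimately show False using gen(4) by blast
  qed
qed

text \<open>The composite \<open>\<iota>\<close> followed by \<open>\<pi>\<close> being the identity makes \<open>\<pi>\<close> map \<open>I\<close> onto \<open>I'\<close>, so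
  \<open>\<pi>\<close> carries generators of \<open>I\<close> to generators of \<open>I'\<close> without raising degrees.\<close>

lemma generated_upto_retract:
  fixes I :: "('x, 'k::field) mpoly set" and I' :: "('y, 'k) mpoly set"
  assumes up: "generated_upto X k I"
    and I': "gen X' I' = I'" "I' \<subseteq> polys X'"
    and inc: "\<And>p. p \<in> I' \<Longrightarrow> mpoly_hom \<iota> p \<in> I"
    and ret: "\<And>p. p \<in> I \<Longrightarrow> mpoly_hom \<pi> p \<in> I'"
    and \<pi>: "\<And>x. x \<in> X \<Longrightarrow> \<pi> x \<in> polys X'" "\<And>x. x \<in> X \<Longrightarrow> homog 1 (\<pi> x)"
    and id: "\<And>x. x \<in> X' \<Longrightarrow> mpoly_hom \<pi> (\<iota> x) = mvar x"
  shows "generated_upto X' k I'"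
proof -
  obtain F where F: "F \<subseteq> polys X" "\<forall>f\<in>F. \<exists>d. int d \<le> k \<and> homog d f" "gen X F = I"
    using up unfolding generated_upto_def by blast
  let ?F = "mpoly_hom \<pi> ` F"
  have "?F \<subseteq> I'" using ret F(3) gen_base by blast
  have "I' \<subseteq> gen X' ?F"
  proof
    fix p assume p: "p \<in> I'"
    have "mpoly_hom \<pi> ` gen X F \<subseteq> gen X' ?F"
    \<comment> \<open>Arguing with the preimage of the target span avoids regrouping sums, since
      different members of \<open>F\<close> may have the same image.\<close>
    proof (subst image_subset_iff_subset_vimage, rule gen_least)
      fix h f :: "('x, 'k) mpoly" assume "f \<in> F" "h \<in> polys X"
      then have "mpoly_hom \<pi> f \<in> gen X' ?F" "mpoly_hom \<pi> h \<in> polys X'"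
        using \<pi>(1) by (auto intro: gen_base mpoly_hom_polys)
      then show "h * f \<in> mpoly_hom \<pi> -` gen X' ?F"
        by (simp add: mpoly_hom_mult gen_mult)
    qed (auto simp: mpoly_hom_add intro: gen_add)
    then have "mpoly_hom \<pi> (mpoly_hom \<iota> p) \<in> gen X' ?F" using inc[OF p] F(3) by blast
    moreover have "mpoly_hom \<pi> (mpoly_hom \<iota> p) = mpoly_hom mvar p"
      unfolding mpoly_hom_comp using p I'(2) id by (intro mpoly_hom_cong[of p X']) auto
    ultimately show "p \<in> gen X' ?F" by (simp add: mpoly_hom_id)
  qed
  then have "gen X' ?F = I'" using gen_mono[OF \<open>?F \<subseteq> I'\<close>, of X'] I'(1) by blast
  moreover have "\<exists>d. int d \<le> k \<and> homog d g" if g: "g \<in> ?F" for g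
  proof -
    obtain f where f: "f \<in> F" "g = mpoly_hom \<pi> f" using g by blast
    obtain d where d: "int d \<le> k" "homog d f" using F(2) f(1) by blast
    have "f \<in> polys X" using f(1) F(1) by blast
    then have "homog d g" using homog_mpoly_hom[OF _ d(2) \<pi>(2)] f(2) by simp
    then show ?thesis using d(1) by blast
  qed
  moreover have "?F \<subseteq> polys X'" using \<open>?F \<subseteq> I'\<close> I'(2) by (rule order_trans)
  ultimately show ?thesis
    unfolding generated_upto_def by (intro exI[of _ ?F] conjI ballI)
qed

section \<open>Cut ideals as graded kernels\<close>

lemma hcomp_mpoly_hom:
  assumes "p \<in> polys X" "\<And>x. x \<in> X \<Longrightarrow> homog n (f x)" "n > 0"
  shows "hcomp (d * n) (mpoly_hom f p) = mpoly_hom f (hcomp d p)"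
proof -
  let ?D = "monom_degree ` keys p"
  have zero: "hcomp d p = 0" if "d \<notin> ?D"
    using that by (intro poly_mapping_eqI) (auto simp: lookup_hcomp when_def in_keys_iff)
  \<comment> \<open>Degree \<open>e\<close> goes to degree \<open>e * n\<close>, and positivity of
    \<open>n\<close> keeps different degrees apart.\<close>
  have comp: "hcomp (d * n) (mpoly_hom f (hcomp e p)) = (if d = e then mpoly_hom f (hcomp e p) else 0)" for e
  proof -
    have "homog (e * n) (mpoly_hom f (hcomp e p))"
      using assms(1,2) by (intro homog_mpoly_hom[of _ X] hcomp_polys homog_hcomp)
    then show ?thesis using \<open>n > 0\<close> by (simp add: hcomp_homog)
  qed
  have "mpoly_hom f p = (\<Sum>e\<in>?D. mpoly_hom f (hcomp e p))"
    by (subst sum_hcomp[of p]) (rule mpoly_hom_sum)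
  then have "hcomp (d * n) (mpoly_hom f p) = (\<Sum>e\<in>?D. if d = e then mpoly_hom f (hcomp e p) else 0)"
    by (simp only: hcomp_sum comp)
  also have "\<dots> = mpoly_hom f (hcomp d p)" using zero by simp
  finally show ?thesis .
qed

text \<open>A single product over all edges, with a choice of variable per edge, is easier to
  reindex along maps between edge sets than the two products in \<open>cut_map\<close>.\<close>

definition cut_monom :: "'a graph \<Rightarrow> 'a set set \<Rightarrow> ('a set edge_var, 'k::field) mpoly" where
  "cut_monom G P = (\<Prod>e\<in>edges G. if e \<in> cut G P then mvar (S_var e) else mvar (T_var e))"

lemma simple_graph_finite_edges: "simple_graph G \<Longrightarrow> finite (edges G)"
  unfolding simple_graph_def by (metis Pow_iff finite_Pow_iff finite_subset subsetI)

lemma cut_subset: "cut G P \<subseteq> edges G"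
  by (auto simp: cut_def)

lemma cut_map_eq:
  assumes "simple_graph G"
  shows "cut_map G = mpoly_hom (cut_monom G)"
proof -
  have fin: "finite (edges G)" using assms by (rule simple_graph_finite_edges)
  have "edges G \<inter> {e. e \<in> cut G P} = cut G P" "edges G \<inter> - {e. e \<in> cut G P} = edges G - cut G P" for P
    using cut_subset[of G P] by auto
  then have "(\<lambda>P. (\<Prod>e\<in>cut G P. mvar (S_var e)) * (\<Prod>e\<in>edges G - cut G P. mvar (T_var e)))
    = (cut_monom G :: _ \<Rightarrow> ('a set edge_var, 'b) mpoly)"
    by (simp add: fun_eq_iff cut_monom_def prod.If_cases[OF fin])
  then show ?thesis by (simp add: cut_map_def)
qed

lemma cut_ideal_eq:
  assumes "simple_graph G"
  shows "cut_ideal G = {p \<in> polys (bipartitions (verts G)). mpoly_hom (cut_monom G) p = 0}"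
  by (simp add: cut_ideal_def a_kernel_def' cut_source_ring_def cut_target_ring_def cut_map_eq[OF assms])

lemma homog_cut_monom: "homog (card (edges G)) (cut_monom G P)"
proof -
  have "homog (\<Sum>e\<in>edges G. 1) (cut_monom G P)"
    unfolding cut_monom_def by (rule homog_prod) (auto intro: homog_mvar)
  then show ?thesis by simp
qed

lemma gen_cut_ideal:
  assumes "simple_graph G"
  shows "gen (bipartitions (verts G)) (cut_ideal G) = cut_ideal G"
proof
  show "gen (bipartitions (verts G)) (cut_ideal G) \<subseteq> cut_ideal G"
    unfolding cut_ideal_eq[OF assms]
    by (rule gen_least) (auto simp: mpoly_hom_add mpoly_hom_mult intro: polys_add polys_mult)
qed (auto intro: gen_base)

text \<open>Each variable goes to a monomial of degree \<open>card (edges G)\<close>, so the kernel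
  is graded once this number is positive. Without edges every variable would map to 1, and the
  kernel would contain \<open>mvar P - 1\<close> but not its components.\<close>

lemma hcomp_cut_ideal:
  assumes "simple_graph G" "edges G \<noteq> {}" "p \<in> cut_ideal G"
  shows "hcomp d p \<in> cut_ideal G"
proof -
  have p: "p \<in> polys (bipartitions (verts G))" "mpoly_hom (cut_monom G) p = 0"
    using assms(3) by (auto simp: cut_ideal_eq[OF assms(1)])
  have "card (edges G) > 0"
    using assms(2) simple_graph_finite_edges[OF assms(1)] by (simp add: card_gt_0_iff)
  then have "mpoly_hom (cut_monom G) (hcomp d p) = hcomp (d * card (edges G)) (mpoly_hom (cut_monom G) p)"
    by (rule hcomp_mpoly_hom[OF p(1) homog_cut_monom, symmetric])
  also have "\<dots> = 0" using p(2) by (simp add: hcomp_homog[of 0 0])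
  finally show ?thesis using hcomp_polys[OF p(1)] by (simp add: cut_ideal_eq[OF assms(1)])
qed

section \<open>Bipartitions, separated vertices and pullbacks\<close>

definition separates :: "'a set set \<Rightarrow> 'a \<Rightarrow> 'a \<Rightarrow> bool" where
  "separates P x y \<longleftrightarrow> (\<forall>A\<in>P. \<not> (x \<in> A \<and> y \<in> A))"

lemma bipartitions_iff: "P \<in> bipartitions V \<longleftrightarrow> (\<exists>A\<subseteq>V. P = {A, V - A})"
proof
  assume "P \<in> bipartitions V"
  then obtain A B where "P = {A, B}" "A \<union> B = V" "A \<inter> B = {}" by (auto simp: bipartitions_def)
  then have "A \<subseteq> V" "P = {A, V - A}" by auto
  then show "\<exists>A\<subseteq>V. P = {A, V - A}" by blast
next
  assume "\<exists>A\<subseteq>V. P = {A, V - A}"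
  then obtain A where "A \<subseteq> V" "P = {A, V - A}" by blast
  then have "P = {A, V - A} \<and> A \<union> (V - A) = V \<and> A \<inter> (V - A) = {}" by auto
  then show "P \<in> bipartitions V" unfolding bipartitions_def by blast
qed

lemma bipartition_side:
  assumes "P \<in> bipartitions V"
  obtains A where "A \<subseteq> V" "P = {A, V - A}"
    "\<And>x y. x \<in> V \<Longrightarrow> y \<in> V \<Longrightarrow> separates P x y \<longleftrightarrow> (x \<in> A) \<noteq> (y \<in> A)"
proof -
  obtain A where A: "A \<subseteq> V" "P = {A, V - A}" using assms by (auto simp: bipartitions_iff)
  then show ?thesis by (intro that[of A]) (auto simp: separates_def)
qed

lemma simple_graph_edge:
  assumes "simple_graph G" "{x, y} \<in> edges G"
  shows "x \<in> verts G" "y \<in> verts G" "x \<noteq> y"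
  using assms by (force simp: simple_graph_def)+

lemma simple_graph_edgeE:
  assumes "simple_graph G" "e \<in> edges G"
  obtains x y where "e = {x, y}" "x \<in> verts G" "y \<in> verts G" "x \<noteq> y"
proof -
  have "e \<subseteq> verts G" "card e = 2" using assms by (simp_all add: simple_graph_def)
  moreover from this(2) obtain x y where "e = {x, y}" "x \<noteq> y" by (auto simp: card_2_iff)
  ultimately show ?thesis using that by blast
qed

text \<open>Cuts are translated into separation because that notion concerns a pair of vertices,
  names no side and passes through pullbacks.\<close>

lemma mem_cut_iff:
  assumes "simple_graph G" "P \<in> bipartitions (verts G)" "{x, y} \<in> edges G"
  shows "{x, y} \<in> cut G P \<longleftrightarrow> separates P x y"
proof -
  obtain A where A: "A \<subseteq> verts G" "P = {A, verts G - A}"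
    and sep: "separates P x y \<longleftrightarrow> (x \<in> A) \<noteq> (y \<in> A)"
    using bipartition_side[OF assms(2)] simple_graph_edge[OF assms(1,3)] by metis
  have V: "x \<in> verts G" "y \<in> verts G" using simple_graph_edge[OF assms(1,3)] by auto
  show ?thesis
  proof
    assume "{x, y} \<in> cut G P"
    then obtain B C i j where "P = {B, C}" "i \<in> B" "j \<in> C" "{x, y} = {i, j}"
      by (auto simp: cut_def)
    then show "separates P x y"
      using A by (auto simp: separates_def doubleton_eq_iff)
  next
    assume "separates P x y"
    then consider "x \<in> A" "y \<in> verts G - A" | "y \<in> A" "x \<in> verts G - A" using sep V by auto
    then show "{x, y} \<in> cut G P"
      unfolding cut_def using A(2) assms(3) by cases (auto simp: insert_commute)
  qed
qed

text \<open>Preimages are restricted to \<open>U\<close> because maps are total on the vertex type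
  and only their values on \<open>U\<close> are controlled.\<close>

definition pullback :: "('a \<Rightarrow> 'b) \<Rightarrow> 'a set \<Rightarrow> 'b set set \<Rightarrow> 'a set set" where
  "pullback g U P = (\<lambda>A. g -` A \<inter> U) ` P"

lemma pullback_bipartition:
  assumes "P \<in> bipartitions V" "\<And>x. x \<in> U \<Longrightarrow> g x \<in> V"
  shows "pullback g U P \<in> bipartitions U"
proof -
  obtain A where "A \<subseteq> V" "P = {A, V - A}" using assms(1) by (auto simp: bipartitions_iff)
  then have "pullback g U P = {g -` A \<inter> U, U - (g -` A \<inter> U)}"
    using assms(2) by (auto simp: pullback_def)
  then show ?thesis unfolding bipartitions_iff by blast
qed

lemma separates_pullback:
  "x \<in> U \<Longrightarrow> y \<in> U \<Longrightarrow> separates (pullback g U P) x y \<longleftrightarrow> separates P (g x) (g y)"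
  by (auto simp: separates_def pullback_def)

section \<open>Folds of graphs and the retracts they induce\<close>

text \<open>A fold is a simplicial map \<open>c\<close> of \<open>G\<close> onto \<open>G'\<close>, with a section \<open>s\<close> on vertices, through
  which every edge of \<open>G'\<close> can be lifted up to collapsed edges in \<open>Z\<close>. For the contraction of
  an edge, \<open>Z\<close> consists of that edge; for a neighborhood-minor, \<open>c\<close> sends all of \<open>W'\<close> to \<open>v\<close> and
  \<open>Z\<close> is empty.\<close>

locale graph_fold =
  fixes G G' :: "'a graph" and c s :: "'a \<Rightarrow> 'a" and Z :: "'a set set"
  assumes G: "simple_graph G" and G': "simple_graph G'" and nonempty: "edges G' \<noteq> {}"
    and c: "x \<in> verts G \<Longrightarrow> c x \<in> verts G'"
    and s: "x \<in> verts G' \<Longrightarrow> s x \<in> verts G"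
    and cs: "x \<in> verts G' \<Longrightarrow> c (s x) = x"
    and Z: "Z \<subseteq> edges G"
    and Z_collapse: "{x, y} \<in> Z \<Longrightarrow> c x = c y"
    and edge: "{x, y} \<in> edges G \<Longrightarrow> c x = c y \<or> {c x, c y} \<in> edges G'"
    and lift: "f \<in> edges G' \<Longrightarrow> \<exists>x y. {x, y} \<in> edges G \<and> f = {c x, c y} \<and>
      (s (c x) = x \<or> {x, s (c x)} \<in> Z) \<and> (s (c y) = y \<or> {y, s (c y)} \<in> Z)"
begin

abbreviation "V \<equiv> verts G"
abbreviation "V' \<equiv> verts G'"
abbreviation "E \<equiv> edges G"
abbreviation "E' \<equiv> edges G'"

lemma finite_E [simp]: "finite E" and finite_E' [simp]: "finite E'"
  using G G' by (auto intro: simple_graph_finite_edges)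

lemma pullback_c: "P \<in> bipartitions V' \<Longrightarrow> pullback c V P \<in> bipartitions V"
  by (erule pullback_bipartition) (rule c)

lemma pullback_s: "Q \<in> bipartitions V \<Longrightarrow> pullback s V' Q \<in> bipartitions V'"
  by (erule pullback_bipartition) (rule s)

lemma pullback_s_c:
  assumes "P \<in> bipartitions V'" shows "pullback s V' (pullback c V P) = P"
proof -
  have "s -` (c -` A \<inter> V) \<inter> V' = A" if "A \<in> P" for A
    using that assms s cs by (auto simp: bipartitions_iff)
  then show ?thesis by (simp add: pullback_def image_image)
qed

lemma cut_pullback_c:
  assumes P: "P \<in> bipartitions V'" and e: "e \<in> E"
  shows "e \<in> cut G (pullback c V P) \<longleftrightarrow> c ` e \<in> cut G' P"
proof -
  obtain x y where xy: "e = {x, y}" "x \<in> V" "y \<in> V" using simple_graph_edgeE[OF G e] by metis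
  have "e \<in> cut G (pullback c V P) \<longleftrightarrow> separates P (c x) (c y)"
    using mem_cut_iff[OF G pullback_c[OF P]] separates_pullback xy e by metis
  also have "\<dots> \<longleftrightarrow> {c x, c y} \<in> cut G' P"
  \<comment> \<open>A collapsed edge has a one-element image, which is no edge; correspondingly a
    bipartition never separates a vertex from itself.\<close>
  proof (cases "c x = c y")
    case True
    have "\<not> separates P (c x) (c x)"
      using bipartition_side[OF P] c[OF xy(2)] by metis
    moreover have "{c x, c x} \<notin> cut G' P"
      using cut_subset[of G' P] simple_graph_edge(3)[OF G'] by blast
    ultimately show ?thesis using True by simp
  next
    case False
    then show ?thesis using edge[of x y] mem_cut_iff[OF G' P] e xy(1) by metis
  qed
  finally show ?thesis by (simp add: xy(1))
qed

text \<open>Edges of \<open>Z\<close> become points under \<open>c\<close>, so the two sides of a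
  pullback cannot split them. This keeps the zero branch of \<pi> away from the image of
  \<iota>.\<close>

lemma pullback_c_not_cut_Z:
  assumes P: "P \<in> bipartitions V'" shows "cut G (pullback c V P) \<inter> Z = {}"
proof -
  have False if e: "e \<in> cut G (pullback c V P)" "e \<in> Z" for e
  proof -
    obtain x y where xy: "e = {x, y}" using simple_graph_edgeE[OF G] e(2) Z by blast
    have "c ` e \<in> cut G' P" using e(1) cut_pullback_c[OF P subsetD[OF Z e(2)]] by blast
    then have "{c x, c y} \<in> E'" using cut_subset[of G' P] by (auto simp: xy)
    then show False using Z_collapse[of x y] e(2) simple_graph_edge(3)[OF G'] xy by blast
  qed
  then show ?thesis by blast
qed

text \<open>Since every cut monomial of \<open>G'\<close> contains exactly one of the two variables of a fixed edge
  \<open>f\<^sub>0\<close>, the constant factor contributed by the collapsed edges can be attached to these variables.\<close>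

lemma cut_monom_pullback_c:
  obtains \<psi> :: "'a set edge_var \<Rightarrow> ('a set edge_var, 'k::field) mpoly"
  where "\<And>P. P \<in> bipartitions V' \<Longrightarrow> cut_monom G (pullback c V P) = mpoly_hom \<psi> (cut_monom G' P)"
proof -
  obtain f0 where f0: "f0 \<in> E'" using nonempty by blast
  \<comment> \<open>Edges whose image is no edge are never cut by a pullback along \<open>c\<close>,
    so they contribute this same product to every cut monomial.\<close>
  define R :: "('a set edge_var, 'k) mpoly" where "R = (\<Prod>e\<in>{e\<in>E. c ` e \<notin> E'}. mvar (T_var e))"
  \<comment> \<open>All edges over \<open>f\<close> are cut exactly when \<open>f\<close> is, so
    each variable of \<open>f\<close> can go to the product of the variables of the same kind over
    its fibre.\<close>
  define \<psi> where "\<psi> = case_edge_var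
    (\<lambda>f. (\<Prod>e\<in>{e\<in>E. c ` e = f}. mvar (S_var e)) * (if f = f0 then R else 1))
    (\<lambda>f. (\<Prod>e\<in>{e\<in>E. c ` e = f}. mvar (T_var e)) * (if f = f0 then R else 1))"
  show ?thesis
  proof (rule that)
    fix P assume P: "P \<in> bipartitions V'"
    define m :: "_ \<Rightarrow> ('a set edge_var, 'k) mpoly" where
      "m e = (if e \<in> cut G (pullback c V P) then mvar (S_var e) else mvar (T_var e))" for e
    have m: "m e = (if c ` e \<in> cut G' P then mvar (S_var e) else mvar (T_var e))" if "e \<in> E" for e
      using cut_pullback_c[OF P that] by (simp add: m_def)
    have "mpoly_hom \<psi> (cut_monom G' P) = (\<Prod>f\<in>E'. if f \<in> cut G' P then \<psi> (S_var f) else \<psi> (T_var f))"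
      unfolding cut_monom_def mpoly_hom_prod by (intro prod.cong) auto
    also have "\<dots> = (\<Prod>f\<in>E'. (\<Prod>e\<in>{e\<in>E. c ` e = f}. m e) * (if f = f0 then R else 1))"
      by (intro prod.cong) (auto simp: \<psi>_def m intro!: prod.cong)
    also have "\<dots> = (\<Prod>f\<in>E'. \<Prod>e\<in>{e\<in>E. c ` e = f}. m e) * R"
      using f0 by (simp add: prod.distrib)
    also have "(\<Prod>f\<in>E'. \<Prod>e\<in>{e\<in>E. c ` e = f}. m e) = prod m {e\<in>E. c ` e \<in> E'}"
    proof -
      have "(\<Prod>f\<in>E'. \<Prod>e\<in>{e\<in>E. c ` e = f}. m e) = (\<Prod>f\<in>E'. prod m {e \<in> {e\<in>E. c ` e \<in> E'}. c ` e = f})"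
        by (intro prod.cong) auto
      also have "\<dots> = prod m {e\<in>E. c ` e \<in> E'}" by (rule prod.group) auto
      finally show ?thesis .
    qed
    also have "R = prod m {e\<in>E. c ` e \<notin> E'}"
      unfolding R_def using m cut_subset[of G' P] by (intro prod.cong) auto
    also have "prod m {e\<in>E. c ` e \<in> E'} * prod m {e\<in>E. c ` e \<notin> E'} = prod m E"
      by (subst prod.union_disjoint[symmetric]) (auto intro!: prod.cong)
    finally show "cut_monom G (pullback c V P) = mpoly_hom \<psi> (cut_monom G' P)"
      by (simp add: cut_monom_def m_def)
  qed
qed

text \<open>Some edge over \<open>f\<close> has endpoints that lie on the section or are joined to
  it by edges of \<open>Z\<close>. If no edge of \<open>Z\<close> is cut, moving along them does not
  change sides. One lift serves all \<open>Q\<close>, which permits a fixed map of edge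
  variables.\<close>

lemma cut_pullback_s:
  assumes f: "f \<in> E'"
  obtains e where "e \<in> E" "c ` e = f"
    "\<And>Q. Q \<in> bipartitions V \<Longrightarrow> cut G Q \<inter> Z = {} \<Longrightarrow> e \<in> cut G Q \<longleftrightarrow> f \<in> cut G' (pullback s V' Q)"
proof -
  obtain x y where xy: "{x, y} \<in> E" "f = {c x, c y}"
    and x: "s (c x) = x \<or> {x, s (c x)} \<in> Z" and y: "s (c y) = y \<or> {y, s (c y)} \<in> Z"
    using lift[OF f] by blast
  have V: "x \<in> V" "y \<in> V" using simple_graph_edge[OF G xy(1)] by auto
  show ?thesis
  proof (rule that[of "{x, y}"])
    fix Q assume Q: "Q \<in> bipartitions V" and noZ: "cut G Q \<inter> Z = {}"
    obtain A where A: "\<And>x y. x \<in> V \<Longrightarrow> y \<in> V \<Longrightarrow> separates Q x y \<longleftrightarrow> (x \<in> A) \<noteq> (y \<in> A)"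
      using bipartition_side[OF Q] by metis
    have same: "s (c z) \<in> A \<longleftrightarrow> z \<in> A" if z: "s (c z) = z \<or> {z, s (c z)} \<in> Z" "z \<in> V" for z
    proof (cases "s (c z) = z")
      case False
      then have zZ: "{z, s (c z)} \<in> Z" using z(1) by blast
      then have "{z, s (c z)} \<notin> cut G Q" "{z, s (c z)} \<in> E" using noZ Z by auto
      then show ?thesis
        using mem_cut_iff[OF G Q] A[of z "s (c z)"] z(2) s[OF c] by blast
    qed simp
    have "f \<in> cut G' (pullback s V' Q) \<longleftrightarrow> separates Q (s (c x)) (s (c y))"
      using mem_cut_iff[OF G' pullback_s[OF Q]] f V c separates_pullback unfolding xy(2) by metis
    also have "\<dots> \<longleftrightarrow> separates Q x y"
      using A s c V same[OF x] same[OF y] by simp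
    also have "\<dots> \<longleftrightarrow> {x, y} \<in> cut G Q"
      using mem_cut_iff[OF G Q xy(1)] by simp
    finally show "{x, y} \<in> cut G Q \<longleftrightarrow> f \<in> cut G' (pullback s V' Q)" by simp
  qed (use xy in auto)
qed

text \<open>The chosen lifts carry the monomial of \<open>G'\<close>. Cut variables of
  \<open>Z\<close> are sent to 0, which produces the zero branch; all remaining variables of edges
  that are not lifts are sent to 1.\<close>

lemma cut_monom_pullback_s:
  obtains \<chi> :: "'a set edge_var \<Rightarrow> ('a set edge_var, 'k::field) mpoly"
  where "\<And>Q. Q \<in> bipartitions V \<Longrightarrow>
    (if cut G Q \<inter> Z = {} then cut_monom G' (pullback s V' Q) else 0) = mpoly_hom \<chi> (cut_monom G Q)"
proof -
  have "\<forall>f\<in>E'. \<exists>e. e \<in> E \<and> c ` e = f \<and>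
    (\<forall>Q\<in>bipartitions V. cut G Q \<inter> Z = {} \<longrightarrow> (e \<in> cut G Q \<longleftrightarrow> f \<in> cut G' (pullback s V' Q)))"
    using cut_pullback_s by metis
  then obtain l where l: "\<And>f. f \<in> E' \<Longrightarrow> l f \<in> E" "\<And>f. f \<in> E' \<Longrightarrow> c ` l f = f"
    "\<And>f Q. f \<in> E' \<Longrightarrow> Q \<in> bipartitions V \<Longrightarrow> cut G Q \<inter> Z = {} \<Longrightarrow>
      l f \<in> cut G Q \<longleftrightarrow> f \<in> cut G' (pullback s V' Q)"
    using bchoice[of E'] by metis
  define \<chi> :: "'a set edge_var \<Rightarrow> ('a set edge_var, 'k) mpoly" where "\<chi> = case_edge_var
    (\<lambda>e. if e \<in> Z then 0 else if e \<in> l ` E' then mvar (S_var (c ` e)) else 1)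
    (\<lambda>e. if e \<in> l ` E' then mvar (T_var (c ` e)) else 1)"
  show ?thesis
  proof (rule that)
    fix Q assume Q: "Q \<in> bipartitions V"
    have hom: "mpoly_hom \<chi> (cut_monom G Q) = (\<Prod>e\<in>E. if e \<in> cut G Q then \<chi> (S_var e) else \<chi> (T_var e))"
      unfolding cut_monom_def mpoly_hom_prod by (intro prod.cong) auto
    show "(if cut G Q \<inter> Z = {} then cut_monom G' (pullback s V' Q) else 0) = mpoly_hom \<chi> (cut_monom G Q)"
    proof (cases "cut G Q \<inter> Z = {}")
      case False
      then obtain e where "e \<in> cut G Q" "e \<in> Z" by blast
      then have "mpoly_hom \<chi> (cut_monom G Q) = 0"
        unfolding hom using Z by (intro prod_zero) (auto simp: \<chi>_def)
      then show ?thesis using False by simp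
    next
      case True
      \<comment> \<open>Taking images under \<open>c\<close> recovers \<open>f\<close> from its lift
        \<open>l f\<close>.\<close>
      have inj: "inj_on l E'" by (rule inj_on_inverseI[of _ "(`) c"]) (rule l(2))
      have "mpoly_hom \<chi> (cut_monom G Q) =
        (\<Prod>e\<in>l ` E'. if e \<in> cut G Q then mvar (S_var (c ` e)) else mvar (T_var (c ` e)))"
        unfolding hom using l(1) True by (intro prod.mono_neutral_cong_right) (auto simp: \<chi>_def)
      also have "\<dots> = (\<Prod>f\<in>E'. if l f \<in> cut G Q then mvar (S_var f) else mvar (T_var f))"
        unfolding prod.reindex[OF inj] using l(2) by (intro prod.cong) auto
      also have "\<dots> = cut_monom G' (pullback s V' Q)"
        unfolding cut_monom_def using l(3) Q True by (intro prod.cong) auto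
      finally show ?thesis using True by simp
    qed
  qed
qed

lemma mu_cut_ideal_le:
  assumes "mu_cut_ideal TYPE('k::field) G \<le> ereal (real_of_int k)"
  shows "mu_cut_ideal TYPE('k) G' \<le> ereal (real_of_int k)"
proof -
  let ?I = "cut_ideal G :: ('a set set, 'k) mpoly set"
  let ?I' = "cut_ideal G' :: ('a set set, 'k) mpoly set"
  obtain \<psi> :: "'a set edge_var \<Rightarrow> ('a set edge_var, 'k) mpoly" where \<psi>:
    "\<And>P. P \<in> bipartitions V' \<Longrightarrow> cut_monom G (pullback c V P) = mpoly_hom \<psi> (cut_monom G' P)"
    using cut_monom_pullback_c by blast
  obtain \<chi> :: "'a set edge_var \<Rightarrow> ('a set edge_var, 'k) mpoly" where \<chi>:
    "\<And>Q. Q \<in> bipartitions V \<Longrightarrow>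
      (if cut G Q \<inter> Z = {} then cut_monom G' (pullback s V' Q) else 0) = mpoly_hom \<chi> (cut_monom G Q)"
    using cut_monom_pullback_s by blast
  define \<iota> :: "'a set set \<Rightarrow> ('a set set, 'k) mpoly" where "\<iota> P = mvar (pullback c V P)" for P
  define \<pi> :: "'a set set \<Rightarrow> ('a set set, 'k) mpoly"
    where "\<pi> Q = (if cut G Q \<inter> Z = {} then mvar (pullback s V' Q) else 0)" for Q
  \<comment> \<open>Edges of \<open>G'\<close> lift, so \<open>G\<close> has edges too, as
    gradedness of its cut ideal requires.\<close>
  have E: "E \<noteq> {}" using nonempty lift by blast
  have I: "?I \<subseteq> polys (bipartitions V)" and I': "?I' \<subseteq> polys (bipartitions V')"
    by (auto simp: cut_ideal_eq[OF G] cut_ideal_eq[OF G'])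
  have up: "generated_upto (bipartitions V) k ?I"
    using assms unfolding mu_cut_ideal_def cut_source_ring_def
    by (rule generated_upto_if_max_generator_degree_le[OF I gen_cut_ideal[OF G], rotated])
      (rule hcomp_cut_ideal[OF G E])
  have \<pi>_polys: "\<pi> Q \<in> polys (bipartitions V')" if "Q \<in> bipartitions V" for Q
    using that by (auto simp: \<pi>_def pullback_s intro: polys_mvar)
  have "generated_upto (bipartitions V') k ?I'"
  proof (rule generated_upto_retract[OF up gen_cut_ideal[OF G'] I', where \<iota> = \<iota> and \<pi> = \<pi>])
    fix p assume "p \<in> ?I'"
    then have p: "p \<in> polys (bipartitions V')" "mpoly_hom (cut_monom G') p = 0"
      by (auto simp: cut_ideal_eq[OF G'])
    \<comment> \<open>The square formed by \<iota>, \<psi> and the two cut maps commutes on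
      variables, hence on all polynomials, so kernel elements go to kernel elements. The same is
      done below with \<pi> and \<chi>.\<close>
    have "mpoly_hom (cut_monom G) (mpoly_hom \<iota> p) = mpoly_hom \<psi> (mpoly_hom (cut_monom G') p)"
      unfolding mpoly_hom_comp using \<psi> by (intro mpoly_hom_cong[OF p(1)]) (simp add: \<iota>_def)
    moreover have "mpoly_hom \<iota> p \<in> polys (bipartitions V)"
      unfolding \<iota>_def by (intro mpoly_hom_polys[OF p(1)] polys_mvar pullback_c)
    ultimately show "mpoly_hom \<iota> p \<in> ?I" using p(2) by (simp add: cut_ideal_eq[OF G])
  next
    fix p assume "p \<in> ?I"
    then have p: "p \<in> polys (bipartitions V)" "mpoly_hom (cut_monom G) p = 0"
      by (auto simp: cut_ideal_eq[OF G])
    have "mpoly_hom (cut_monom G') (mpoly_hom \<pi> p) = mpoly_hom \<chi> (mpoly_hom (cut_monom G) p)"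
      unfolding mpoly_hom_comp
    proof (rule mpoly_hom_cong[OF p(1)])
      fix Q assume "Q \<in> bipartitions V"
      from \<chi>[OF this] show "mpoly_hom (cut_monom G') (\<pi> Q) = mpoly_hom \<chi> (cut_monom G Q)"
        by (simp add: \<pi>_def split: if_splits)
    qed
    moreover have "mpoly_hom \<pi> p \<in> polys (bipartitions V')"
      by (rule mpoly_hom_polys[OF p(1) \<pi>_polys])
    ultimately show "mpoly_hom \<pi> p \<in> ?I'" using p(2) by (simp add: cut_ideal_eq[OF G'])
  next
    fix P assume "P \<in> bipartitions V'"
    then show "mpoly_hom \<pi> (\<iota> P) = mvar P"
      using pullback_c_not_cut_Z pullback_s_c by (simp add: \<iota>_def \<pi>_def)
  qed (use \<pi>_polys in \<open>auto simp: \<pi>_def intro: homog_mvar\<close>)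
  then show ?thesis
    unfolding mu_cut_ideal_def cut_source_ring_def by (rule max_generator_degree_le_if_generated_upto)
qed

end

section \<open>Contractions and neighborhood-minors as folds\<close>

lemma simple_graph_contract:
  assumes "simple_graph G" "{u, v} \<in> edges G" "w \<notin> verts G - {u, v}"
  shows "simple_graph (contract G u v w)"
  unfolding simple_graph_def
proof (intro conjI ballI)
  fix e assume "e \<in> edges (contract G u v w)"
  then consider "e \<in> edges G" "e \<inter> {u, v} = {}" | z where "e = {w, z}" "z \<in> verts G - {u, v}"
    by (auto simp: contract_def)
  then have "e \<subseteq> verts (contract G u v w) \<and> card e = 2"
  proof cases
    case 1
    then show ?thesis using assms(1) by (auto simp: simple_graph_def contract_def)
  next
    case 2
    then show ?thesis using assms(3) by (auto simp: contract_def card_2_iff)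
  qed
  then show "e \<subseteq> verts (contract G u v w)" "card e = 2" by auto
qed (use assms(1) in \<open>auto simp: simple_graph_def contract_def\<close>)

lemma graph_fold_contract:
  assumes G: "simple_graph G" and uv: "{u, v} \<in> edges G" and w: "w \<notin> verts G - {u, v}"
    and nonempty: "edges (contract G u v w) \<noteq> {}"
  shows "\<exists>c s Z. graph_fold G (contract G u v w) c s Z"
proof -
  define c where "c x = (if x \<in> {u, v} then w else x)" for x
  \<comment> \<open>The merged vertex is represented by \<open>u\<close>. An edge at
    \<open>w\<close> may lift only to an edge at \<open>v\<close>; then \<open>v\<close> is joined
    to \<open>u\<close> by the contracted edge, the single member of \<open>Z\<close>.\<close>
  define s where "s x = (if x = w then u else x)" for x
  have c_in: "c x = w" if "x \<in> {u, v}" for x using that by (simp add: c_def)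
  have c_out: "c x = x" if "x \<notin> {u, v}" for x using that by (simp add: c_def)
  have sc_in: "s (c x) = u" if "x \<in> {u, v}" for x using that by (simp add: c_def s_def)
  \<comment> \<open>The name \<open>w\<close> may be \<open>u\<close> or \<open>v\<close>; it only
    has to differ from the other vertices for \<open>s\<close> to undo \<open>c\<close> on
    them.\<close>
  have sc_out: "s (c x) = x" if "x \<in> verts G - {u, v}" for x using that w by (auto simp: c_def s_def)
  have V: "u \<in> verts G" "v \<in> verts G" using simple_graph_edge[OF G uv] by auto
  have verts: "verts (contract G u v w) = (verts G - {u, v}) \<union> {w}" by (simp add: contract_def)
  have "graph_fold G (contract G u v w) c s {{u, v}}"
  proof
    show "simple_graph (contract G u v w)" by (rule simple_graph_contract[OF G uv w])
  next
    fix x assume "x \<in> verts G"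
    then show "c x \<in> verts (contract G u v w)" by (auto simp: verts c_def)
  next
    fix x assume "x \<in> verts (contract G u v w)"
    then show "s x \<in> verts G" "c (s x) = x" using V by (auto simp: verts c_def s_def)
  next
    fix x y assume "{x, y} \<in> {{u, v}}"
    then show "c x = c y" by (auto simp: doubleton_eq_iff c_def)
  next
    fix x y assume xy: "{x, y} \<in> edges G"
    note xyV = simple_graph_edge[OF G xy]
    consider "x \<in> {u, v}" "y \<in> {u, v}" | "x \<in> {u, v}" "y \<notin> {u, v}"
      | "x \<notin> {u, v}" "y \<in> {u, v}" | "x \<notin> {u, v}" "y \<notin> {u, v}" by blast
    then show "c x = c y \<or> {c x, c y} \<in> edges (contract G u v w)"
    proof cases
      case 1
      then show ?thesis by (simp add: c_in)
    next
      case 2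
      then have "{y, u} \<in> edges G \<or> {y, v} \<in> edges G" using xy by (auto simp: insert_commute)
      then show ?thesis unfolding c_in[OF 2(1)] c_out[OF 2(2)] using 2(2) xyV by (auto simp: contract_def)
    next
      case 3
      then have "{x, u} \<in> edges G \<or> {x, v} \<in> edges G" using xy by auto
      then show ?thesis
        unfolding c_in[OF 3(2)] c_out[OF 3(1)] insert_commute[of x w] using 3(1) xyV
        by (auto simp: contract_def)
    next
      case 4
      then show ?thesis using xy by (auto simp: c_out contract_def)
    qed
  next
    fix f assume "f \<in> edges (contract G u v w)"
    then consider "f \<in> edges G" "f \<inter> {u, v} = {}"
      | z where "f = {w, z}" "z \<in> verts G - {u, v}" "{z, u} \<in> edges G \<or> {z, v} \<in> edges G"
      unfolding contract_def by auto
    then show "\<exists>x y. {x, y} \<in> edges G \<and> f = {c x, c y} \<and>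
      (s (c x) = x \<or> {x, s (c x)} \<in> {{u, v}}) \<and> (s (c y) = y \<or> {y, s (c y)} \<in> {{u, v}})"
    proof cases
      case 1
      obtain x y where f: "f = {x, y}" "x \<in> verts G" "y \<in> verts G"
        using simple_graph_edgeE[OF G 1(1)] by metis
      then have "x \<in> verts G - {u, v}" "y \<in> verts G - {u, v}" using 1(2) by auto
      then have "s (c x) = x" "s (c y) = y" "f = {c x, c y}" using f(1) sc_out c_out by auto
      moreover have "{x, y} \<in> edges G" using 1(1) f(1) by simp
      ultimately show ?thesis by blast
    next
      case (2 z)
      obtain t where t: "t \<in> {u, v}" "{t, z} \<in> edges G" using 2(3) by (auto simp: insert_commute)
      have "s (c t) = t \<or> {t, s (c t)} \<in> {{u, v}}" using t(1) sc_in[OF t(1)] by auto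
      moreover have "s (c z) = z" by (rule sc_out[OF 2(2)])
      moreover have "f = {c t, c z}" using 2(1,2) c_in[OF t(1)] c_out[of z] by simp
      ultimately show ?thesis using t(2) by blast
    qed
  qed (use G uv nonempty in simp_all)
  then show ?thesis by blast
qed

lemma simple_graph_induced:
  assumes "simple_graph G" "W \<subseteq> verts G" "W \<noteq> {}"
  shows "simple_graph (induced G W)"
  using assms by (auto simp: simple_graph_def induced_def intro: finite_subset)

text \<open>An edge leaving \<open>W\<close> at \<open>x\<close> is mapped to the pair of
  \<open>x\<close> and \<open>v\<close>, which the neighborhood condition makes a point or an edge
  of the minor. Edges inside \<open>W\<close> are their own lifts, so the inclusion is a section and
  \<open>Z\<close> can be empty.\<close>

lemma graph_fold_neighborhood_minor:
  assumes G: "simple_graph G" and V: "verts G = W \<union> W'" and v: "v \<in> W"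
    and nbrs: "W \<inter> set_nbrs G W' \<subseteq> closed_nbrs (induced G W) v"
    and nonempty: "edges (induced G W) \<noteq> {}"
  shows "\<exists>c s Z. graph_fold G (induced G W) c s Z"
proof -
  define c where "c x = (if x \<in> W then x else v)" for x
  have c_in: "c x = x" if "x \<in> W" for x using that by (simp add: c_def)
  have c_out: "c x = v" if "x \<notin> W" for x using that by (simp add: c_def)
  have edge: "x = v \<or> {x, v} \<in> edges (induced G W)" if "{x, y} \<in> edges G" "x \<in> W" "y \<notin> W" for x y
  proof -
    have "y \<in> W'" using simple_graph_edge[OF G that(1)] V that(3) by auto
    then have "x \<in> set_nbrs G W'" using that(1) by (auto simp: set_nbrs_def nbrs_def)
    then show ?thesis using nbrs that(2) by (auto simp: closed_nbrs_def nbrs_def)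
  qed
  have "graph_fold G (induced G W) c id {}"
  proof
    show "simple_graph (induced G W)" using G V v by (intro simple_graph_induced) auto
  next
    fix x assume "x \<in> verts (induced G W)"
    then show "id x \<in> verts G" "c (id x) = x" using V by (auto simp: induced_def c_in)
  next
    fix x y assume xy: "{x, y} \<in> edges G"
    consider "x \<in> W" "y \<in> W" | "x \<in> W" "y \<notin> W" | "x \<notin> W" "y \<in> W" | "x \<notin> W" "y \<notin> W" by blast
    then show "c x = c y \<or> {c x, c y} \<in> edges (induced G W)"
    proof cases
      case 1
      then show ?thesis using xy by (simp add: c_in induced_def)
    next
      case 2
      then show ?thesis using edge[OF xy] by (simp add: c_in c_out)
    next
      case 3
      have "{y, x} \<in> edges G" using xy by (simp add: insert_commute)
      then show ?thesis using edge[of y x] 3 by (auto simp: c_in c_out insert_commute)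
    next
      case 4
      then show ?thesis by (simp add: c_out)
    qed
  next
    fix f assume "f \<in> edges (induced G W)"
    then have f: "f \<in> edges G" "f \<subseteq> W" by (auto simp: induced_def)
    then obtain x y where xy: "f = {x, y}" using simple_graph_edgeE[OF G] by metis
    then have "id (c x) = x" "id (c y) = y" "f = {c x, c y}" using f(2) by (auto simp: c_in)
    moreover have "{x, y} \<in> edges G" using f(1) xy by simp
    ultimately show "\<exists>x y. {x, y} \<in> edges G \<and> f = {c x, c y} \<and>
      (id (c x) = x \<or> {x, id (c x)} \<in> {}) \<and> (id (c y) = y \<or> {y, id (c y)} \<in> {})"
      by blast
  qed (use G v nonempty in \<open>auto simp: induced_def c_def\<close>)
  then show ?thesis by blast
qed

section \<open>Induction along a sequence of retract steps\<close>

theorem corollary6p4: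
  fixes G G' :: "'a graph" and k :: int
  assumes "simple_graph G" and "edges G \<noteq> {}" and "edges G' \<noteq> {}"
    and "combinatorial_retract G G'"
    and "mu_cut_ideal TYPE('k::field) G \<le> ereal (real_of_int k)"
  shows "mu_cut_ideal TYPE('k) G' \<le> ereal (real_of_int k)"
proof -
  have "(\<lambda>G G'. edge_contraction G G' \<or> neighborhood_minor G G')\<^sup>*\<^sup>* G G'"
    using assms(4) by (simp add: combinatorial_retract_def)
  \<comment> \<open>The bound is claimed only for graphs with edges, as folds require. If a step
    produces a graph with edges, the graph before it has edges as well, so the induction hypothesis
    applies.\<close>
  then have "simple_graph G' \<and> (edges G' \<noteq> {} \<longrightarrow> mu_cut_ideal TYPE('k) G' \<le> ereal (real_of_int k))"
  proof (induction rule: rtranclp_induct)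
    case base
    then show ?case using assms(1,5) by simp
  next
    case (step H H')
    note H = step.IH[THEN conjunct1]
    from step.hyps(2) show ?case
    proof
      assume "edge_contraction H H'"
      then obtain u v w where uvw: "{u, v} \<in> edges H" "w \<notin> verts H - {u, v}" "H' = contract H u v w"
        unfolding edge_contraction_def by blast
      have "mu_cut_ideal TYPE('k) H' \<le> ereal (real_of_int k)" if ne: "edges H' \<noteq> {}"
      proof -
        obtain c s Z where "graph_fold H H' c s Z"
          using graph_fold_contract[OF H uvw(1,2)] ne unfolding uvw(3) by blast
        moreover have "mu_cut_ideal TYPE('k) H \<le> ereal (real_of_int k)" using step.IH uvw(1) by blast
        ultimately show ?thesis by (rule graph_fold.mu_cut_ideal_le)
      qed
      then show ?thesis using simple_graph_contract[OF H uvw(1,2)] uvw(3) by blast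
    next
      assume "neighborhood_minor H H'"
      then obtain W W' v where W: "verts H = W \<union> W'" "H' = induced H W" "v \<in> W"
        "W \<inter> set_nbrs H W' \<subseteq> closed_nbrs (induced H W) v"
        unfolding neighborhood_minor_def by blast
      have "mu_cut_ideal TYPE('k) H' \<le> ereal (real_of_int k)" if ne: "edges H' \<noteq> {}"
      proof -
        have "edges H \<noteq> {}" using ne W(2) by (auto simp: induced_def)
        then have "mu_cut_ideal TYPE('k) H \<le> ereal (real_of_int k)" using step.IH by blast
        moreover obtain c s Z where "graph_fold H H' c s Z"
          using graph_fold_neighborhood_minor[OF H W(1,3,4)] ne unfolding W(2) by blast
        ultimately show ?thesis by (rule graph_fold.mu_cut_ideal_le[rotated])
      qed
      moreover have "simple_graph H'"
        unfolding W(2) by (rule simple_graph_induced[OF H]) (use W(1,3) in auto)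
      ultimately show ?thesis by blast
    qed
  qed
  then show ?thesis using assms(3) by blast
qed

end
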